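(* Let $I\times_fM^n$ be a warped product such that $\mathcal{H}(t)\geq1$ for all $t\in I$. Let $p>2$ and let $\Sigma^n$ be a complete non-compact helix-type hypersurface contained in a slab of $I\times_fM^n$ with $\lambda_{1,p}(\Sigma)=0$. If the mean curvature $H$ of $\Sigma^n$ (not necessarily constant) satisfies $H^2\leq1$, then $\Sigma^n$ is a slice.
   Context: Let $(M^n,\langle\cdot,\cdot\rangle_M)$ be a connected oriented $n$-dimensional Riemannian manifold, $n\geq2$, $I\subset\mathbb{R}$ an interval, and $f:I\to\mathbb{R}$ a positive smooth function. The warped product $I\times_fM^n$ is the product manifold $I\times M^n$ with the metric $dt^2+f(t)^2\langle\cdot,\cdot\rangle_M$. Put $\mathcal{H}(t)=f'(t)/f(t)$ and let $\partial_t$ be the unit coordinate vector field tangent to $I$. The slices are the hypersurfaces $M^n_t=\{t\}\times M^n$, $t\in I$. A hypersurface is given by an isometric immersion $x:\Sigma^n\to I\times_fM^n$ of a connected manifold $\Sigma^n$ (with the induced metric), with unit normal field $N$, shape operator $A(X)=-\overline{\nabla}_XN$ (where $\overline\nabla$ is the Levi-Civita connection of $I\times_fM^n$) and mean curvature $H=\frac1n\mathrm{tr}(A)$. It is contained in a slab if $x(\Sigma)\subset[t_1,t_2]\times M^n$ for some $[t_1,t_2]\subset I$ with $t_1<t_2$. It is of helix type if the angle function $\langle N,\partial_t\rangle$ is constant on $\Sigma^n$. "$\Sigma^n$ is a slice" means $x(\Sigma^n)=M^n_t$ for some $t\in I$. Here $\lambda_{1,p}(\Sigma)=\inf\{\int_\Sigma|\nabla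 u|^p/\int_\Sigma|u|^p: u\in W^{1,p}_0(\Sigma)\setminus\{0\}\}$ is the first eigenvalue of the $p$-Laplacian $\Delta_pu=\mathrm{div}(|\nabla u|^{p-2}\nabla u)$ on $\Sigma^n$. *)

theory Defs
  imports "HOL-Analysis.Analysis"
begin

section \<open>Smooth maps between subsets of Euclidean spaces\<close>

text \<open>
  Derivatives are taken within the domain.  On an open set these are the ordinary derivatives;
  on a product of a nondegenerate interval with an open set they are one-sided in the interval
  direction at an end point, and still unique.
\<close>

primrec Ck_on :: "nat \<Rightarrow> 'a::euclidean_space set \<Rightarrow> ('a \<Rightarrow> 'b::real_normed_vector) \<Rightarrow> bool" where
  "Ck_on 0 S F \<longleftrightarrow> continuous_on S F"
| "Ck_on (Suc k) S F \<longleftrightarrow> F differentiable_on S \<and>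
     (\<forall>v. Ck_on k S (\<lambda>y. frechet_derivative F (at y within S) v))"

definition smooth_on :: "'a::euclidean_space set \<Rightarrow> ('a \<Rightarrow> 'b::real_normed_vector) \<Rightarrow> bool" where
  "smooth_on S F \<longleftrightarrow> (\<forall>k. Ck_on k S F)"


section \<open>Manifolds and Riemannian metrics\<close>

text \<open>
  A chart is a pair of its domain and its coordinate map; the values of the coordinate map
  outside the domain are irrelevant.

  Tangent vectors and tensors are given by their components: a vector at \<open>q\<close> is a family of
  coordinate vectors \<open>X c\<close>, one for each chart \<open>c\<close> around \<open>q\<close>, related by the Jacobians of the
  transition maps, and a metric is a family of bilinear forms \<open>g c q\<close> related correspondingly.
\<close>

type_synonym ('m, 'e) chart = "'m set \<times> ('m \<Rightarrow> 'e)"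
type_synonym ('m, 'e) metric_field = "('m, 'e) chart \<Rightarrow> 'm \<Rightarrow> 'e \<Rightarrow> 'e \<Rightarrow> real"
type_synonym ('m, 'e) vector_field = "('m, 'e) chart \<Rightarrow> 'm \<Rightarrow> 'e"

definition chart_inv :: "('m, 'e) chart \<Rightarrow> 'e \<Rightarrow> 'm" where
  "chart_inv c = inv_into (fst c) (snd c)"

definition chart_at :: "('m, 'e) chart set \<Rightarrow> 'm \<Rightarrow> ('m, 'e) chart" where
  "chart_at A q = (SOME c. c \<in> A \<and> q \<in> fst c)"

definition jacobian ::
  "('m, 'e::euclidean_space) chart \<Rightarrow> ('m, 'e) chart \<Rightarrow> 'm \<Rightarrow> 'e \<Rightarrow> 'e" where
  "jacobian c d q =
     frechet_derivative (snd d \<circ> chart_inv c) (at (snd c q) within snd c ` (fst c \<inter> fst d))"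

definition smooth_atlas :: "('m::topological_space, 'e::euclidean_space) chart set \<Rightarrow> bool" where
  "smooth_atlas A \<longleftrightarrow>
     (\<forall>c\<in>A. open (fst c) \<and> open (snd c ` fst c) \<and>
            homeomorphism (fst c) (snd c ` fst c) (snd c) (chart_inv c)) \<and>
     (\<Union>c\<in>A. fst c) = UNIV \<and>
     (\<forall>c\<in>A. \<forall>d\<in>A. smooth_on (snd c ` (fst c \<inter> fst d)) (snd d \<circ> chart_inv c))"

definition oriented_atlas :: "('m, real^'n) chart set \<Rightarrow> bool" where
  "oriented_atlas A \<longleftrightarrow>
     (\<forall>c\<in>A. \<forall>d\<in>A. \<forall>q\<in>fst c \<inter> fst d. det (matrix (jacobian c d q)) > 0)"

definition riemannian_metric ::
  "('m, 'e::euclidean_space) chart set \<Rightarrow> ('m, 'e) metric_field \<Rightarrow> bool" where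
  "riemannian_metric A g \<longleftrightarrow>
     (\<forall>c\<in>A. \<forall>q\<in>fst c. bilinear (g c q) \<and> (\<forall>v w. g c q v w = g c q w v) \<and>
                       (\<forall>v. v \<noteq> 0 \<longrightarrow> g c q v v > 0)) \<and>
     (\<forall>c\<in>A. \<forall>v w. smooth_on (snd c ` fst c) (\<lambda>y. g c (chart_inv c y) v w)) \<and>
     (\<forall>c\<in>A. \<forall>d\<in>A. \<forall>q\<in>fst c \<inter> fst d. \<forall>v w.
        g c q v w = g d q (jacobian c d q v) (jacobian c d q w))"

text \<open>
  A manifold is a whole type; second countability is required through the sort constraint.
\<close>

definition connected_riemannian_manifold ::
  "('m::{t2_space,second_countable_topology}, 'e::euclidean_space) chart set
     \<Rightarrow> ('m, 'e) metric_field \<Rightarrow> bool" where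
  "connected_riemannian_manifold A g \<longleftrightarrow>
     smooth_atlas A \<and> riemannian_metric A g \<and> connected (UNIV :: 'm set)"


section \<open>Warped products\<close>

text \<open>
  The warped product has carrier \<open>I \<times> UNIV\<close>; its charts are the products of the inclusion of \<open>I\<close>
  with the charts of the fibre.  The interval may contain its end points.
  In every product chart the unit field \<open>\<partial>\<^sub>t\<close> has components \<open>(1, 0)\<close>.
\<close>

definition product_chart :: "real set \<Rightarrow> ('m, 'e) chart \<Rightarrow> (real \<times> 'm, real \<times> 'e) chart" where
  "product_chart I c = (I \<times> fst c, \<lambda>(t, q). (t, snd c q))"

text \<open>For nonempty \<open>I\<close>, this recovers \<open>c\<close> from \<open>product_chart I c\<close>.\<close>

definition fibre_chart :: "(real \<times> 'm, real \<times> 'e) chart \<Rightarrow> ('m, 'e) chart" where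
  "fibre_chart D = (snd ` fst D, \<lambda>q. snd (snd D (0, q)))"

lemma fibre_chart_product_chart: "I \<noteq> {} \<Longrightarrow> fibre_chart (product_chart I c) = c"
  by (cases c) (auto simp: fibre_chart_def product_chart_def)

definition warped_atlas :: "real set \<Rightarrow> ('m, 'e) chart set \<Rightarrow> (real \<times> 'm, real \<times> 'e) chart set" where
  "warped_atlas I A = product_chart I ` A"

definition warped_metric ::
  "(real \<Rightarrow> real) \<Rightarrow> ('m, 'e) metric_field \<Rightarrow> (real \<times> 'm, real \<times> 'e) metric_field" where
  "warped_metric f g D z V W =
     fst V * fst W + (f (fst z))\<^sup>2 * g (fibre_chart D) (snd z) (snd V) (snd W)"

definition log_deriv :: "real set \<Rightarrow> (real \<Rightarrow> real) \<Rightarrow> real \<Rightarrow> real" where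
  "log_deriv I f t = vector_derivative f (at t within I) / f t"


section \<open>The Levi-Civita connection\<close>

text \<open>Directional derivative, in the direction \<open>v\<close>, of a function written in the chart \<open>D\<close>.\<close>

definition chart_deriv ::
  "('m, 'e::euclidean_space) chart \<Rightarrow> ('m \<Rightarrow> real) \<Rightarrow> 'm \<Rightarrow> 'e \<Rightarrow> real" where
  "chart_deriv D F q v =
     frechet_derivative (F \<circ> chart_inv D) (at (snd D q) within snd D ` fst D) v"

text \<open>
  \<open>christoffel G D q v w\<close> is \<open>\<Gamma>\<^sup>k\<^sub>i\<^sub>j v\<^sup>i w\<^sup>j\<close>, that is, the components of the covariant derivative
  of \<open>w\<close> in the direction \<open>v\<close>, where \<open>w\<close> is extended with constant components in \<open>D\<close>.
  It is given by the Koszul formula for vector fields with constant components.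
\<close>

definition christoffel ::
  "('m, 'e::euclidean_space) metric_field \<Rightarrow> ('m, 'e) chart \<Rightarrow> 'm \<Rightarrow> 'e \<Rightarrow> 'e \<Rightarrow> 'e" where
  "christoffel G D q v w = (THE u. \<forall>z.
     2 * G D q u z = chart_deriv D (\<lambda>r. G D r w z) q v + chart_deriv D (\<lambda>r. G D r v z) q w
                     - chart_deriv D (\<lambda>r. G D r v w) q z)"


section \<open>Isometrically immersed hypersurfaces\<close>

text \<open>
  Below, \<open>x\<close> maps a manifold with atlas \<open>A\<close> to the union of the chart domains in \<open>B\<close>.
\<close>

definition smooth_map ::
  "('s::topological_space, 'd::euclidean_space) chart set
     \<Rightarrow> ('m::topological_space, 'e::euclidean_space) chart set \<Rightarrow> ('s \<Rightarrow> 'm) \<Rightarrow> bool" where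
  "smooth_map A B x \<longleftrightarrow>
     continuous_on UNIV x \<and> range x \<subseteq> (\<Union>D\<in>B. fst D) \<and>
     (\<forall>c\<in>A. \<forall>D\<in>B. smooth_on (snd c ` (fst c \<inter> x -` fst D)) (snd D \<circ> x \<circ> chart_inv c))"

definition differential ::
  "('s \<Rightarrow> 'm) \<Rightarrow> ('s, 'd::euclidean_space) chart \<Rightarrow> ('m, 'e::euclidean_space) chart
     \<Rightarrow> 's \<Rightarrow> 'd \<Rightarrow> 'e" where
  "differential x c D s = frechet_derivative (snd D \<circ> x \<circ> chart_inv c) (at (snd c s))"

definition isometric_immersion ::
  "('s::topological_space, 'd::euclidean_space) chart set \<Rightarrow> ('s, 'd) metric_field
     \<Rightarrow> ('m::topological_space, 'e::euclidean_space) chart set \<Rightarrow> ('m, 'e) metric_field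
     \<Rightarrow> ('s \<Rightarrow> 'm) \<Rightarrow> bool" where
  "isometric_immersion A h B G x \<longleftrightarrow>
     smooth_map A B x \<and>
     (\<forall>c\<in>A. \<forall>D\<in>B. \<forall>s\<in>fst c \<inter> x -` fst D.
        inj (differential x c D s) \<and>
        (\<forall>v w. h c s v w = G D (x s) (differential x c D s v) (differential x c D s w)))"

text \<open>Here \<open>N\<close> is a vector field along \<open>x\<close>: \<open>N D s\<close> are the components at \<open>x s\<close> in the chart \<open>D\<close>.\<close>

definition unit_normal_field ::
  "('s::topological_space, 'd::euclidean_space) chart set
     \<Rightarrow> ('m::topological_space, 'e::euclidean_space) chart set \<Rightarrow> ('m, 'e) metric_field
     \<Rightarrow> ('s \<Rightarrow> 'm) \<Rightarrow> (('m, 'e) chart \<Rightarrow> 's \<Rightarrow> 'e) \<Rightarrow> bool" where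
  "unit_normal_field A B G x N \<longleftrightarrow>
     (\<forall>c\<in>A. \<forall>D\<in>B. smooth_on (snd c ` (fst c \<inter> x -` fst D)) (N D \<circ> chart_inv c)) \<and>
     (\<forall>D\<in>B. \<forall>E\<in>B. \<forall>s\<in>x -` (fst D \<inter> fst E). N E s = jacobian D E (x s) (N D s)) \<and>
     (\<forall>D\<in>B. \<forall>s\<in>x -` fst D. G D (x s) (N D s) (N D s) = 1) \<and>
     (\<forall>c\<in>A. \<forall>D\<in>B. \<forall>s\<in>fst c \<inter> x -` fst D. \<forall>v.
        G D (x s) (N D s) (differential x c D s v) = 0)"

text \<open>
  Covariant derivative of \<open>N\<close> along \<open>x\<close> in the direction of the tangent vector with components
  \<open>v\<close> in the chart \<open>c\<close>, and the shape operator.  The former is tangent to the hypersurface when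
  \<open>N\<close> is a unit normal field, which makes the definite description meaningful.
\<close>

definition cov_deriv_along ::
  "('m, 'e::euclidean_space) metric_field \<Rightarrow> ('s \<Rightarrow> 'm) \<Rightarrow> (('m, 'e) chart \<Rightarrow> 's \<Rightarrow> 'e)
     \<Rightarrow> ('s, 'd::euclidean_space) chart \<Rightarrow> ('m, 'e) chart \<Rightarrow> 's \<Rightarrow> 'd \<Rightarrow> 'e" where
  "cov_deriv_along G x N c D s v =
     frechet_derivative (N D \<circ> chart_inv c) (at (snd c s)) v
       + christoffel G D (x s) (differential x c D s v) (N D s)"

definition shape_operator ::
  "('m, 'e::euclidean_space) metric_field \<Rightarrow> ('s \<Rightarrow> 'm) \<Rightarrow> (('m, 'e) chart \<Rightarrow> 's \<Rightarrow> 'e)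
     \<Rightarrow> ('s, 'd::euclidean_space) chart \<Rightarrow> ('m, 'e) chart \<Rightarrow> 's \<Rightarrow> 'd \<Rightarrow> 'd" where
  "shape_operator G x N c D s v =
     (THE a. differential x c D s a = - cov_deriv_along G x N c D s v)"

text \<open>The trace does not depend on the charts used, so this determines \<open>H\<close>.\<close>

definition is_mean_curvature ::
  "('s, real^'n) chart set \<Rightarrow> ('m, 'e::euclidean_space) chart set \<Rightarrow> ('m, 'e) metric_field
     \<Rightarrow> ('s \<Rightarrow> 'm) \<Rightarrow> (('m, 'e) chart \<Rightarrow> 's \<Rightarrow> 'e) \<Rightarrow> ('s \<Rightarrow> real) \<Rightarrow> bool" where
  "is_mean_curvature A B G x N H \<longleftrightarrow>
     (\<forall>c\<in>A. \<forall>D\<in>B. \<forall>s\<in>fst c \<inter> x -` fst D.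
        H s = 1 / real CARD('n) * trace (matrix (shape_operator G x N c D s)))"

definition helix_type ::
  "(real \<times> 'm, real \<times> 'e::euclidean_space) chart set \<Rightarrow> (real \<times> 'm, real \<times> 'e) metric_field
     \<Rightarrow> ('s \<Rightarrow> real \<times> 'm) \<Rightarrow> ((real \<times> 'm, real \<times> 'e) chart \<Rightarrow> 's \<Rightarrow> real \<times> 'e) \<Rightarrow> bool" where
  "helix_type B G x N \<longleftrightarrow>
     (\<exists>\<theta>. \<forall>D\<in>B. \<forall>s\<in>x -` fst D. G D (x s) (N D s) (1, 0) = \<theta>)"

definition in_slab :: "real set \<Rightarrow> ('s \<Rightarrow> real \<times> 'm) \<Rightarrow> bool" where
  "in_slab I x \<longleftrightarrow> (\<exists>t1 t2. t1 < t2 \<and> {t1..t2} \<subseteq> I \<and> range x \<subseteq> {t1..t2} \<times> UNIV)"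

definition is_slice :: "real set \<Rightarrow> ('s \<Rightarrow> real \<times> 'm) \<Rightarrow> bool" where
  "is_slice I x \<longleftrightarrow> (\<exists>t\<in>I. range x = {t} \<times> UNIV)"


section \<open>Riemannian distance and completeness\<close>

definition piecewise_C1_curve ::
  "('m::topological_space, 'e::euclidean_space) chart set \<Rightarrow> (real \<Rightarrow> 'm) \<Rightarrow> bool" where
  "piecewise_C1_curve A \<gamma> \<longleftrightarrow>
     continuous_on {0..1} \<gamma> \<and>
     (\<exists>K. finite K \<and>
        (\<forall>c\<in>A. (snd c \<circ> \<gamma>) C1_differentiable_on {t \<in> {0<..<1} - K. \<gamma> t \<in> fst c}))"

definition tangent_norm ::
  "('m, 'e) chart set \<Rightarrow> ('m, 'e) metric_field \<Rightarrow> ('m, 'e) vector_field \<Rightarrow> 'm \<Rightarrow> real" where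
  "tangent_norm A g X q = (let c = chart_at A q in sqrt (g c q (X c q) (X c q)))"

definition curve_length ::
  "('m, 'e::euclidean_space) chart set \<Rightarrow> ('m, 'e) metric_field \<Rightarrow> (real \<Rightarrow> 'm) \<Rightarrow> ennreal" where
  "curve_length A g \<gamma> =
     (\<integral>\<^sup>+t\<in>{0..1}. ennreal (tangent_norm A g
         (\<lambda>c q. vector_derivative (snd c \<circ> \<gamma>) (at t)) (\<gamma> t)) \<partial>lborel)"

definition riemannian_dist ::
  "('m::topological_space, 'e::euclidean_space) chart set \<Rightarrow> ('m, 'e) metric_field
     \<Rightarrow> 'm \<Rightarrow> 'm \<Rightarrow> ennreal" where
  "riemannian_dist A g q r =
     (INF \<gamma>\<in>{\<gamma>. piecewise_C1_curve A \<gamma> \<and> \<gamma> 0 = q \<and> \<gamma> 1 = r}. curve_length A g \<gamma>)"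

definition riemannian_complete ::
  "('m::topological_space, 'e::euclidean_space) chart set \<Rightarrow> ('m, 'e) metric_field \<Rightarrow> bool" where
  "riemannian_complete A g \<longleftrightarrow>
     (\<forall>X :: nat \<Rightarrow> 'm.
        (\<forall>\<epsilon>>0. \<exists>k0. \<forall>k\<ge>k0. \<forall>l\<ge>k0. riemannian_dist A g (X k) (X l) < ennreal \<epsilon>) \<longrightarrow>
        (\<exists>q. \<forall>\<epsilon>>0. \<exists>k0. \<forall>k\<ge>k0. riemannian_dist A g (X k) q < ennreal \<epsilon>))"


section \<open>Volume, Sobolev spaces and the first eigenvalue of the p-Laplacian\<close>

text \<open>
  The Riemannian measure is the Borel measure with density \<open>sqrt (det g\<^sub>i\<^sub>j)\<close> in every chart;
  it is determined uniquely by this, since countably many charts cover the manifold.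
\<close>

definition gram_matrix ::
  "('m, real^'n) metric_field \<Rightarrow> ('m, real^'n) chart \<Rightarrow> 'm \<Rightarrow> real^'n^'n" where
  "gram_matrix g c q = (\<chi> i j. g c q (axis i 1) (axis j 1))"

definition is_riemannian_volume ::
  "('m::topological_space, real^'n) chart set \<Rightarrow> ('m, real^'n) metric_field
     \<Rightarrow> 'm measure \<Rightarrow> bool" where
  "is_riemannian_volume A g \<mu> \<longleftrightarrow>
     sets \<mu> = sets borel \<and>
     (\<forall>c\<in>A. \<forall>E\<in>sets borel. E \<subseteq> fst c \<longrightarrow>
        emeasure \<mu> E =
          (\<integral>\<^sup>+y\<in>snd c ` E. ennreal (sqrt (det (gram_matrix g c (chart_inv c y)))) \<partial>lborel))"

definition vector_field_on :: "('m, 'e::euclidean_space) chart set \<Rightarrow> ('m, 'e) vector_field \<Rightarrow> bool" where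
  "vector_field_on A X \<longleftrightarrow>
     (\<forall>c\<in>A. \<forall>d\<in>A. \<forall>q\<in>fst c \<inter> fst d. X d q = jacobian c d q (X c q))"

definition gradient ::
  "('m, 'e::euclidean_space) metric_field \<Rightarrow> ('m \<Rightarrow> real) \<Rightarrow> ('m, 'e) vector_field" where
  "gradient g \<phi> c q = (THE w. \<forall>v. g c q w v = chart_deriv c \<phi> q v)"

definition test_functions ::
  "('m::topological_space, 'e::euclidean_space) chart set \<Rightarrow> ('m \<Rightarrow> real) set" where
  "test_functions A =
     {\<phi>. (\<forall>c\<in>A. smooth_on (snd c ` fst c) (\<phi> \<circ> chart_inv c)) \<and> compact (closure {q. \<phi> q \<noteq> 0})}"

text \<open>
  \<open>X\<close> is a weak gradient of \<open>u\<close> if, in every chart, its metric dual, the form \<open>g(X, \<cdot>)\<close>, is the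
  weak differential of \<open>u\<close>.
\<close>

definition weak_gradient ::
  "('m::topological_space, 'e::euclidean_space) chart set \<Rightarrow> ('m, 'e) metric_field
     \<Rightarrow> ('m \<Rightarrow> real) \<Rightarrow> ('m, 'e) vector_field \<Rightarrow> bool" where
  "weak_gradient A g u X \<longleftrightarrow>
     vector_field_on A X \<and>
     (\<forall>c\<in>A. X c \<in> borel_measurable (restrict_space borel (fst c))) \<and>
     (\<forall>c\<in>A. \<forall>\<psi> :: 'e \<Rightarrow> real. \<forall>v.
        smooth_on UNIV \<psi> \<and> compact (closure {y. \<psi> y \<noteq> 0}) \<and>
        closure {y. \<psi> y \<noteq> 0} \<subseteq> snd c ` fst c \<longrightarrow>
        (LINT y:snd c ` fst c|lborel. u (chart_inv c y) * frechet_derivative \<psi> (at y) v) =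
        - (LINT y:snd c ` fst c|lborel.
             g c (chart_inv c y) (X c (chart_inv c y)) v * \<psi> y))"

definition Lp_fun :: "'m measure \<Rightarrow> real \<Rightarrow> ('m \<Rightarrow> real) \<Rightarrow> bool" where
  "Lp_fun \<mu> p u \<longleftrightarrow> u \<in> borel_measurable \<mu> \<and> integrable \<mu> (\<lambda>q. \<bar>u q\<bar> powr p)"

text \<open>
  Elements of \<open>W\<^sup>1\<^sup>,\<^sup>p\<close> are represented by pairs of a function and its weak gradient, and
  \<open>W\<^sub>0\<^sup>1\<^sup>,\<^sup>p\<close> is the closure of the test functions in the Sobolev norm.
\<close>

definition sobolev ::
  "('m::topological_space, 'e::euclidean_space) chart set \<Rightarrow> ('m, 'e) metric_field
     \<Rightarrow> 'm measure \<Rightarrow> real \<Rightarrow> ('m \<Rightarrow> real) \<Rightarrow> ('m, 'e) vector_field \<Rightarrow> bool" where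
  "sobolev A g \<mu> p u X \<longleftrightarrow>
     Lp_fun \<mu> p u \<and> weak_gradient A g u X \<and> Lp_fun \<mu> p (tangent_norm A g X)"

definition sobolev_0 ::
  "('m::topological_space, 'e::euclidean_space) chart set \<Rightarrow> ('m, 'e) metric_field
     \<Rightarrow> 'm measure \<Rightarrow> real \<Rightarrow> ('m \<Rightarrow> real) \<Rightarrow> ('m, 'e) vector_field \<Rightarrow> bool" where
  "sobolev_0 A g \<mu> p u X \<longleftrightarrow>
     sobolev A g \<mu> p u X \<and>
     (\<exists>\<phi>. (\<forall>k::nat. \<phi> k \<in> test_functions A) \<and>
        (\<lambda>k. LINT q|\<mu>. \<bar>u q - \<phi> k q\<bar> powr p) \<longlonglongrightarrow> 0 \<and>
        (\<lambda>k. LINT q|\<mu>. tangent_norm A g (\<lambda>c r. X c r - gradient g (\<phi> k) c r) q powr p)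
          \<longlonglongrightarrow> 0)"

definition first_eigenvalue ::
  "('m::topological_space, 'e::euclidean_space) chart set \<Rightarrow> ('m, 'e) metric_field
     \<Rightarrow> 'm measure \<Rightarrow> real \<Rightarrow> real" where
  "first_eigenvalue A g \<mu> p =
     Inf {(LINT q|\<mu>. tangent_norm A g X q powr p) / (LINT q|\<mu>. \<bar>u q\<bar> powr p) | u X.
            sobolev_0 A g \<mu> p u X \<and> \<not> (AE q in \<mu>. u q = 0)}"

end

theory Submission
  imports Defs
begin

text \<open>
  Let \<open>\<theta>\<close> be the constant value of the angle function and let \<open>h\<close> be the height, the projection of the
  immersion to \<open>I\<close>.  The gradient of \<open>h\<close> on \<open>\<Sigma>\<close> is the tangential part \<open>\<partial>\<^sub>t - \<theta> N\<close> of the unit field \<open>\<partial>\<^sub>t\<close>,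
  so it has the constant length \<open>sqrt (1 - \<theta>\<^sup>2)\<close>.  In a slab \<open>h\<close> is bounded above.  A function that is
  bounded above on a complete manifold has points at which its gradient is arbitrarily small, by
  Ekeland's variational principle (\<open>caristi_minimum\<close>, \<open>almost_critical_point\<close>).  Therefore
  \<open>\<theta>\<^sup>2 = 1\<close> (\<open>steep_height_unbounded\<close>), the normal is \<open>\<plusminus>\<partial>\<^sub>t\<close>, and \<open>h\<close> is a constant \<open>t\<close> because \<open>\<Sigma>\<close> is
  connected (\<open>height_constant\<close>).

  It remains to see that the image is the whole slice.  The projection of \<open>\<Sigma>\<close> to the fibre is now, up to
  the factor \<open>f t\<close>, a local isometry from a complete manifold.  The same principle, applied to
  the distance in coordinates from a given point of a small coordinate ball of \<open>M\<close>, shows that the image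
  contains the whole ball as soon as it meets it (\<open>fibre_ball_covered\<close>): the only point at which the
  pulled back distance can have small gradient is a zero.  Since \<open>M\<close> is connected, the image is \<open>M\<close>.

  The variational principle needs a complete pseudometric whose convergent sequences converge in the
  topology.  For the Riemannian distance, symmetry and the triangle inequality come from the affine
  reparametrisation of curves, and the comparison with the topology from bump functions, which are
  Lipschitz for the distance (\<open>lipschitz_along_curve\<close>, \<open>riemannian_dist_topology\<close>).
\<close>

section \<open>A variational principle on complete pseudometric spaces\<close>

text \<open>
  A form of Ekeland's variational principle.  Call \<open>b\<close> reachable from \<open>a\<close> if the descent of \<open>F\<close> from
  \<open>a\<close> to \<open>b\<close> pays, at the rate \<open>C\<close>, for the distance.  By the triangle inequality reachability is
  transitive, so a sequence that always moves to an almost lowest reachable point is Cauchy, because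
  its total length is paid for by the bounded total descent.  From its limit nothing lower can be
  reached.
\<close>

lemma caristi_minimum:
  fixes d :: "'a \<Rightarrow> 'a \<Rightarrow> ennreal" and F :: "'a \<Rightarrow> real"
  assumes refl: "\<And>a. d a a = 0" and sym: "\<And>a b. d a b = d b a"
    and tri: "\<And>a b c. d a c \<le> d a b + d b c"
    and complete: "\<And>X :: nat \<Rightarrow> 'a.
        \<forall>\<epsilon>>0. \<exists>k0. \<forall>k\<ge>k0. \<forall>l\<ge>k0. d (X k) (X l) < ennreal \<epsilon> \<Longrightarrow>
        \<exists>q. \<forall>\<epsilon>>0. \<exists>k0. \<forall>k\<ge>k0. d (X k) q < ennreal \<epsilon>"
    and cont: "\<And>X q. \<forall>\<epsilon>>0. \<exists>k0. \<forall>k\<ge>k0. d (X k) q < ennreal \<epsilon> \<Longrightarrow> (\<lambda>k. F (X k)) \<longlonglongrightarrow> F q"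
    and nonneg: "\<And>a. 0 \<le> F a" and C: "0 \<le> C"
  shows "\<exists>q. F q \<le> F a \<and> (\<forall>b. d q b \<le> ennreal (C * (F q - F b)) \<longrightarrow> F q \<le> F b)"
proof -
  define S where "S s = {b. d s b \<le> ennreal (C * (F s - F b)) \<and> F b \<le> F s}" for s
  have S_self: "s \<in> S s" for s by (simp add: S_def refl)
  have S_trans: "c \<in> S s" if "b \<in> S s" "c \<in> S b" for s b c
  proof -
    have "d s c \<le> d s b + d b c" by (rule tri)
    also have "\<dots> \<le> ennreal (C * (F s - F b)) + ennreal (C * (F b - F c))"
      using that by (intro add_mono) (auto simp: S_def)
    also have "\<dots> = ennreal (C * (F s - F c))"
      using that C by (subst ennreal_plus[symmetric]) (auto simp: S_def algebra_simps mult_left_mono)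
    finally show ?thesis using that by (auto simp: S_def)
  qed
  have bdd: "bdd_below (F ` S s)" for s by (rule bdd_belowI2[of _ 0]) (rule nonneg)
  have ex: "\<exists>b. b \<in> S s \<and> F b < Inf (F ` S s) + 1 / Suc k" for s k
  proof -
    have "F ` S s \<noteq> {}" using S_self by blast
    then have "\<exists>y\<in>F ` S s. y < Inf (F ` S s) + 1 / Suc k"
      by (subst cInf_less_iff[symmetric, OF _ bdd]) auto
    then show ?thesis by auto
  qed
  define X where "X = rec_nat a (\<lambda>k s. SOME b. b \<in> S s \<and> F b < Inf (F ` S s) + 1 / Suc k)"
  have X0: "X 0 = a" by (simp add: X_def)
  have XS: "X (Suc k) \<in> S (X k)" "F (X (Suc k)) < Inf (F ` S (X k)) + 1 / Suc k" for k
    using someI_ex[OF ex[of "X k" k]] by (simp_all add: X_def)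
  have X_le: "X l \<in> S (X k)" if "k \<le> l" for k l
    using that by (induction l rule: dec_induct) (auto intro: S_self S_trans XS)
  then have "decseq (\<lambda>k. F (X k))" by (auto simp: decseq_def S_def)
  then obtain L where L: "(\<lambda>k. F (X k)) \<longlonglongrightarrow> L" "\<And>k. L \<le> F (X k)"
    using decseq_convergent[of "\<lambda>k. F (X k)" 0] nonneg by metis
  have dX: "d (X k) (X l) \<le> ennreal (C * (F (X k) - L))" if "k \<le> l" for k l
  proof -
    have "d (X k) (X l) \<le> ennreal (C * (F (X k) - F (X l)))" using X_le[OF that] by (simp add: S_def)
    also have "\<dots> \<le> ennreal (C * (F (X k) - L))"
      using C L(2)[of l] by (intro ennreal_leI mult_left_mono) auto
    finally show ?thesis .
  qed
  have lim0: "(\<lambda>k. C * (F (X k) - L)) \<longlonglongrightarrow> C * (L - L)" by (intro tendsto_intros L)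
  have "\<forall>\<epsilon>>0. \<exists>k0. \<forall>k\<ge>k0. \<forall>l\<ge>k0. d (X k) (X l) < ennreal \<epsilon>"
  proof (intro allI impI)
    fix \<epsilon> :: real assume "\<epsilon> > 0"
    then have "\<forall>\<^sub>F k in sequentially. C * (F (X k) - L) < \<epsilon>" using order_tendstoD(2)[OF lim0] by simp
    then obtain k0 where k0: "\<And>k. k \<ge> k0 \<Longrightarrow> C * (F (X k) - L) < \<epsilon>"
      by (auto simp: eventually_sequentially)
    have "d (X k) (X l) < ennreal \<epsilon>" if "k \<ge> k0" "l \<ge> k0" for k l
    proof -
      have "d (X k) (X l) \<le> ennreal (C * (F (X (min k l)) - L))"
        using dX[of k l] dX[of l k] sym[of "X k" "X l"] by (cases "k \<le> l") (auto simp: min_def)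
      also have "\<dots> < ennreal \<epsilon>" using k0[of "min k l"] that \<open>\<epsilon> > 0\<close> by (simp add: ennreal_lessI)
      finally show ?thesis .
    qed
    then show "\<exists>k0. \<forall>k\<ge>k0. \<forall>l\<ge>k0. d (X k) (X l) < ennreal \<epsilon>" by blast
  qed
  from complete[OF this] obtain q where q: "\<forall>\<epsilon>>0. \<exists>k0. \<forall>k\<ge>k0. d (X k) q < ennreal \<epsilon>" by blast
  have Fq: "F q = L" using LIMSEQ_unique[OF cont[OF q] L(1)] .
  have qS: "q \<in> S (X k)" for k
  proof -
    have "d (X k) q \<le> ennreal (C * (F (X k) - L)) + ennreal \<epsilon>" if pos: "\<epsilon> > 0" for \<epsilon>
    proof -
      obtain k0 where k0: "\<And>l. l \<ge> k0 \<Longrightarrow> d (X l) q < ennreal \<epsilon>"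
        using q[rule_format, OF pos] by blast
      have "d (X k) q \<le> d (X k) (X (max k k0)) + d (X (max k k0)) q" by (rule tri)
      also have "\<dots> \<le> ennreal (C * (F (X k) - L)) + ennreal \<epsilon>"
        by (intro add_mono dX less_imp_le[OF k0]) auto
      finally show ?thesis .
    qed
    then have "d (X k) q \<le> ennreal (C * (F (X k) - L))"
      by (rule ennreal_le_epsilon)
    then show ?thesis using L(2)[of k] by (simp add: S_def Fq)
  qed
  have "F q \<le> F b" if "d q b \<le> ennreal (C * (F q - F b))" for b
  proof (rule ccontr)
    assume "\<not> F q \<le> F b"
    then have "b \<in> S q" using that by (auto simp: S_def)
    then have "b \<in> S (X k)" for k using qS S_trans by blast
    then have "Inf (F ` S (X k)) \<le> F b" for k by (intro cInf_lower bdd) auto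
    then have *: "F (X (Suc k)) \<le> F b + 1 / Suc k" for k using XS(2)[of k] by (smt (verit))
    have "(\<lambda>k. F (X (Suc k))) \<longlonglongrightarrow> L" using L(1) by (rule LIMSEQ_Suc)
    moreover have "(\<lambda>k. F b + 1 / real (Suc k)) \<longlonglongrightarrow> F b + 0"
      by (intro tendsto_intros LIMSEQ_Suc[OF lim_const_over_n])
    ultimately have "L \<le> F b + 0" using * by (intro LIMSEQ_le[of _ L _ "F b + 0"]) auto
    then show False using \<open>\<not> F q \<le> F b\<close> Fq by simp
  qed
  moreover have "F q \<le> F a" using qS[of 0] X0 by (simp add: S_def)
  ultimately show ?thesis by blast
qed

section \<open>Charts and the metric in coordinates\<close>

locale riemannian_manifold =
  fixes A :: "('m::t2_space, 'e::euclidean_space) chart set" and g :: "('m, 'e) metric_field"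
  assumes atlas: "smooth_atlas A" and metric: "riemannian_metric A g"
begin

lemma chart_open: "c \<in> A \<Longrightarrow> open (fst c)" "c \<in> A \<Longrightarrow> open (snd c ` fst c)"
  and chart_homeo: "c \<in> A \<Longrightarrow> homeomorphism (fst c) (snd c ` fst c) (snd c) (chart_inv c)"
  using atlas by (auto simp: smooth_atlas_def)

lemma chart_inv_left: "c \<in> A \<Longrightarrow> q \<in> fst c \<Longrightarrow> chart_inv c (snd c q) = q"
  using chart_homeo by (auto simp: homeomorphism_def)

lemma chart_inv_right: "c \<in> A \<Longrightarrow> y \<in> snd c ` fst c \<Longrightarrow> snd c (chart_inv c y) = y"
  and chart_inv_in: "c \<in> A \<Longrightarrow> y \<in> snd c ` fst c \<Longrightarrow> chart_inv c y \<in> fst c"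
  by (auto simp: chart_inv_left)

lemma chart_cont: "c \<in> A \<Longrightarrow> continuous_on (fst c) (snd c)"
  and chart_inv_cont: "c \<in> A \<Longrightarrow> continuous_on (snd c ` fst c) (chart_inv c)"
  using chart_homeo by (auto simp: homeomorphism_def)

lemma chart_cover: "(\<Union>c\<in>A. fst c) = UNIV"
  using atlas by (simp add: smooth_atlas_def)

lemma chart_exists: obtains c where "c \<in> A" "q \<in> fst c"
  using chart_cover by blast

lemma chart_at: "chart_at A q \<in> A" "q \<in> fst (chart_at A q)"
proof -
  have "\<exists>c. c \<in> A \<and> q \<in> fst c" using chart_exists by metis
  from someI_ex[OF this] show "chart_at A q \<in> A" "q \<in> fst (chart_at A q)" by (auto simp: chart_at_def)
qed

lemma chart_image_open:
  assumes "c \<in> A" "open U" shows "open (snd c ` (fst c \<inter> U))"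
proof -
  have "snd c ` (fst c \<inter> U) = snd c ` fst c \<inter> chart_inv c -` U"
    by (auto simp: chart_inv_left[OF assms(1)])
  then show ?thesis
    using continuous_open_preimage[OF chart_inv_cont chart_open(2) assms(2)] assms(1) by simp
qed

lemma transition_smooth:
  "c \<in> A \<Longrightarrow> d \<in> A \<Longrightarrow> smooth_on (snd c ` (fst c \<inter> fst d)) (snd d \<circ> chart_inv c)"
  using atlas by (auto simp: smooth_atlas_def)

lemma transition_has_derivative:
  assumes "c \<in> A" "d \<in> A" "q \<in> fst c \<inter> fst d"
  shows "(snd d \<circ> chart_inv c has_derivative jacobian c d q) (at (snd c q))"
proof -
  let ?S = "snd c ` (fst c \<inter> fst d)"
  have o: "open ?S" using assms chart_open chart_image_open by blast
  have "Ck_on (Suc 0) ?S (snd d \<circ> chart_inv c)"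
    using transition_smooth[OF assms(1,2)] by (auto simp only: smooth_on_def)
  then have "snd d \<circ> chart_inv c differentiable (at (snd c q) within ?S)"
    using assms by (auto simp: differentiable_on_def)
  then have "(snd d \<circ> chart_inv c has_derivative jacobian c d q) (at (snd c q) within ?S)"
    unfolding jacobian_def by (simp add: frechet_derivative_works)
  moreover have mem: "snd c q \<in> ?S" using assms(3) by (rule imageI)
  ultimately show ?thesis unfolding at_within_open[OF mem o] by - 
qed

lemma metric_inner_product:
  assumes a: "c \<in> A" "q \<in> fst c"
  shows metric_bilinear: "bilinear (g c q)"
    and metric_pos: "v \<noteq> 0 \<Longrightarrow> g c q v v > 0"
proof -
  have 0: "\<forall>c\<in>A. \<forall>q\<in>fst c. bilinear (g c q) \<and> (\<forall>v w. g c q v w = g c q w v) \<and>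
          (\<forall>v. v \<noteq> 0 \<longrightarrow> g c q v v > 0)"
    using metric unfolding riemannian_metric_def by (elim conjE)
  have 1: "bilinear (g c q) \<and> (\<forall>v w. g c q v w = g c q w v) \<and> (\<forall>v. v \<noteq> 0 \<longrightarrow> g c q v v > 0)"
    using 0[rule_format, OF a] by (intro conjI; blast)
  show "bilinear (g c q)" using 1 by (rule conjunct1)
  have 2: "\<forall>v. v \<noteq> 0 \<longrightarrow> g c q v v > 0" using 1 by (elim conjE)
  show "v \<noteq> 0 \<Longrightarrow> g c q v v > 0"
     using 2 by blast
qed

lemma metric_change:
  assumes "c \<in> A" "d \<in> A" "q \<in> fst c \<inter> fst d"
  shows "g c q v w = g d q (jacobian c d q v) (jacobian c d q w)"
proof -
  have *: "\<forall>c\<in>A. \<forall>d\<in>A. \<forall>q\<in>fst c \<inter> fst d. \<forall>v w.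
        g c q v w = g d q (jacobian c d q v) (jacobian c d q w)"
    using metric unfolding riemannian_metric_def by (elim conjE)
  show ?thesis by (rule *[rule_format, OF assms])
qed

lemma metric_nonneg: "c \<in> A \<Longrightarrow> q \<in> fst c \<Longrightarrow> g c q v v \<ge> 0"
  using metric_pos[of c q v] bilinear_lzero[OF metric_bilinear[of c q], of 0]
  by (cases "v = 0") auto

lemma metric_scale: "c \<in> A \<Longrightarrow> q \<in> fst c \<Longrightarrow> g c q (a *\<^sub>R v) (a *\<^sub>R v) = a\<^sup>2 * g c q v v"
  by (simp add: bilinear_lmul[OF metric_bilinear] bilinear_rmul[OF metric_bilinear] power2_eq_square)

lemma metric_coefficient_cont:
  assumes "c \<in> A" shows "continuous_on (fst c) (\<lambda>q. g c q v w)"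
proof -
  have "smooth_on (snd c ` fst c) (\<lambda>y. g c (chart_inv c y) v w)"
    using metric[unfolded riemannian_metric_def, THEN conjunct2, THEN conjunct1] assms by simp
  then have "Ck_on 0 (snd c ` fst c) (\<lambda>y. g c (chart_inv c y) v w)"
    by (auto simp only: smooth_on_def)
  then have "continuous_on (snd c ` fst c) (\<lambda>y. g c (chart_inv c y) v w)" by simp
  from continuous_on_compose[OF chart_cont[OF assms] this]
  show ?thesis by (rule continuous_on_eq) (simp add: chart_inv_left[OF assms])
qed

lemma metric_cont:
  assumes "c \<in> A" "continuous_on T \<gamma>" "\<gamma> ` T \<subseteq> fst c" "continuous_on T w"
  shows "continuous_on T (\<lambda>t. g c (\<gamma> t) (w t) (w t))"
proof -
  have co: "continuous_on T (\<lambda>t. g c (\<gamma> t) i j)" for i j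
    using continuous_on_compose2[OF metric_coefficient_cont[OF assms(1)] assms(2,3)] .
  have "g c (\<gamma> t) (w t) (w t)
      = (\<Sum>(i,j)\<in>Basis \<times> Basis. (w t \<bullet> i) * ((w t \<bullet> j) * g c (\<gamma> t) i j))" if "t \<in> T" for t
  proof -
    have b: "bilinear (g c (\<gamma> t))" using metric_bilinear assms that by blast
    have "g c (\<gamma> t) (w t) (w t)
      = g c (\<gamma> t) (\<Sum>i\<in>Basis. (w t \<bullet> i) *\<^sub>R i) (\<Sum>i\<in>Basis. (w t \<bullet> i) *\<^sub>R i)"
      by (simp add: euclidean_representation)
    then show ?thesis
      by (simp add: bilinear_sum[OF b] bilinear_lmul[OF b] bilinear_rmul[OF b] mult.left_commute)
  qed
  moreover have "continuous_on T
      (\<lambda>t. \<Sum>(i,j)\<in>Basis \<times> Basis. (w t \<bullet> i) * ((w t \<bullet> j) * g c (\<gamma> t) i j))"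
    unfolding split_beta by (intro continuous_intros co assms)
  ultimately show ?thesis by (simp cong: continuous_on_cong)
qed

text \<open>
  The quotient of the two norms is homogeneous of degree 0 in the vector, hence is determined by its
  values on the product of the compact set with the Euclidean unit sphere, where it attains a positive
  minimum and a maximum.
\<close>

lemma metric_comparable_on_compact:
  assumes c: "c \<in> A" and K: "compact K" "K \<subseteq> snd c ` fst c"
  obtains a b where "a > 0" "b > 0"
    "\<And>y v. y \<in> K \<Longrightarrow> a * norm v \<le> sqrt (g c (chart_inv c y) v v)"
    "\<And>y v. y \<in> K \<Longrightarrow> sqrt (g c (chart_inv c y) v v) \<le> b * norm v"
proof (cases "K = {}")
  case True then show ?thesis using that[of 1 1] by auto
next
  case False
  let ?P = "K \<times> sphere (0::'e) 1" and ?G = "\<lambda>z. sqrt (g c (chart_inv c (fst z)) (snd z) (snd z))"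
  have cP: "compact ?P" using K by (simp add: compact_Times)
  have neP: "?P \<noteq> {}" using False vector_choose_size[of 1] by (auto simp: sphere_def)
  have ci: "continuous_on ?P (\<lambda>z. chart_inv c (fst z))"
    by (rule continuous_on_compose2[OF chart_inv_cont[OF c]]) (use K in \<open>auto intro!: continuous_intros\<close>)
  have cG: "continuous_on ?P ?G"
    by (intro continuous_intros metric_cont[OF c] ci) (use K chart_inv_in[OF c] in auto)
  obtain m where m: "m \<in> ?P" "\<And>z. z \<in> ?P \<Longrightarrow> ?G m \<le> ?G z"
    using continuous_attains_inf[OF cP neP cG] by blast
  obtain M where M: "M \<in> ?P" "\<And>z. z \<in> ?P \<Longrightarrow> ?G z \<le> ?G M"
    using continuous_attains_sup[OF cP neP cG] by blast
  have pos: "?G m > 0"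
  proof -
    have "snd m \<noteq> 0" using m(1) by auto
    moreover have "chart_inv c (fst m) \<in> fst c" using m(1) K(2) by (intro chart_inv_in[OF c]) auto
    ultimately show ?thesis using metric_pos[OF c] by simp
  qed
  \<comment> \<open>At \<open>v = 0\<close> the normalised vector is 0 as well, and both sides vanish.\<close>
  have hom: "sqrt (g c (chart_inv c y) v v) = norm v * ?G (y, v /\<^sub>R norm v)" if "y \<in> K" for y v
  proof (cases "v = 0")
    case True
    have "chart_inv c y \<in> fst c" using that K chart_inv_in[OF c] by auto
    then show ?thesis using True bilinear_lzero[OF metric_bilinear[OF c], of "chart_inv c y" 0] by simp
  next
    case False
    have "chart_inv c y \<in> fst c" using that K chart_inv_in[OF c] by auto
    from metric_scale[OF c this, of "norm v" "v /\<^sub>R norm v"] False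
    show ?thesis by (simp add: real_sqrt_mult)
  qed
  have P: "v \<noteq> 0 \<Longrightarrow> y \<in> K \<Longrightarrow> (y, v /\<^sub>R norm v) \<in> ?P" for y v by simp
  show ?thesis
  proof (rule that[of "?G m" "?G M"])
    show "?G m > 0" by fact
    then show "?G M > 0" using m(2)[OF M(1)] by linarith
    show "?G m * norm v \<le> sqrt (g c (chart_inv c y) v v)" if "y \<in> K" for y v
    proof -
      have "norm v * ?G m \<le> norm v * ?G (y, v /\<^sub>R norm v)"
        proof (cases "v = 0")
        case False show ?thesis by (intro mult_left_mono m(2) P False that norm_ge_zero)
      qed simp
      then show ?thesis by (subst hom[OF that]) (simp only: mult.commute)
    qed
    show "sqrt (g c (chart_inv c y) v v) \<le> ?G M * norm v" if "y \<in> K" for y v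
    proof -
      have "norm v * ?G (y, v /\<^sub>R norm v) \<le> norm v * ?G M"
        proof (cases "v = 0")
        case False show ?thesis by (intro mult_left_mono M(2) P False that norm_ge_zero)
      qed simp
      then show ?thesis by (subst hom[OF that]) (simp only: mult.commute)
    qed
  qed
qed

end

section \<open>Lengths of curves and the Riemannian distance\<close>

lemma C1_differentiable_on_affine:
  fixes f h :: "real \<Rightarrow> 'a::real_normed_vector"
  assumes f: "f C1_differentiable_on S" and T: "open T"
    and eq: "\<And>t. t \<in> T \<Longrightarrow> \<alpha> * t + \<beta> \<in> S \<and> h t = f (\<alpha> * t + \<beta>)"
  shows "h C1_differentiable_on T"
proof -
  obtain D where D: "\<And>s. s \<in> S \<Longrightarrow> (f has_vector_derivative D s) (at s)" "continuous_on S D"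
    using f by (auto simp: C1_differentiable_on_def)
  have "(h has_vector_derivative \<alpha> *\<^sub>R D (\<alpha> * t + \<beta>)) (at t)" if "t \<in> T" for t
  proof -
    have "((\<lambda>t. \<alpha> * t + \<beta>) has_vector_derivative \<alpha>) (at t)"
      by (auto intro!: derivative_eq_intros simp: has_real_derivative_iff_has_vector_derivative[symmetric])
    from vector_diff_chain_at[OF this, of f "D (\<alpha> * t + \<beta>)"] D(1) eq[OF that]
    have "(f \<circ> (\<lambda>t. \<alpha> * t + \<beta>) has_vector_derivative \<alpha> *\<^sub>R D (\<alpha> * t + \<beta>)) (at t)"
      by auto
    then show ?thesis
      by (rule has_vector_derivative_transform_within_open[OF _ T that]) (simp add: eq)
  qed
  moreover have "continuous_on T (\<lambda>t. \<alpha> *\<^sub>R D (\<alpha> * t + \<beta>))"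
  proof (rule continuous_on_scaleR[OF continuous_on_const])
    show "continuous_on T (\<lambda>t. D (\<alpha> * t + \<beta>))"
      by (rule continuous_on_compose2[OF D(2), of T "\<lambda>t. \<alpha> * t + \<beta>"])
         (use eq in \<open>auto intro!: continuous_on_add continuous_on_mult_left\<close>)
  qed
  ultimately show ?thesis
    unfolding C1_differentiable_on_def
    by (intro exI[of _ "\<lambda>t. \<alpha> *\<^sub>R D (\<alpha> * t + \<beta>)"] conjI ballI)
qed

lemma C1_differentiable_on_open_Un:
  assumes "f C1_differentiable_on S" "f C1_differentiable_on T" "open S" "open T"
  shows "f C1_differentiable_on (S \<union> T)"
  using assms unfolding C1_differentiable_on_eq by (auto intro: continuous_on_open_Un)

context riemannian_manifold
begin

definition speed :: "(real \<Rightarrow> 'm) \<Rightarrow> real \<Rightarrow> real" where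
  "speed \<gamma> t = tangent_norm A g (\<lambda>c q. vector_derivative (snd c \<circ> \<gamma>) (at t)) (\<gamma> t)"

text \<open>
  A piecewise \<open>C\<^sup>1\<close> curve together with its finite set of exceptional parameters.  The set need not lie
  in the unit interval.
\<close>

definition C1_off :: "real set \<Rightarrow> (real \<Rightarrow> 'm) \<Rightarrow> bool" where
  "C1_off K \<gamma> \<longleftrightarrow> finite K \<and> continuous_on {0..1} \<gamma> \<and>
     (\<forall>c\<in>A. (snd c \<circ> \<gamma>) C1_differentiable_on (({0<..<1} - K) \<inter> \<gamma> -` fst c))"

lemma piecewise_C1_curve_iff: "piecewise_C1_curve A \<gamma> \<longleftrightarrow> (\<exists>K. C1_off K \<gamma>)"
proof -
  have "{t \<in> {0<..<1} - K. \<gamma> t \<in> fst c} = ({0<..<1} - K) \<inter> \<gamma> -` fst c" for K and c :: "('m, 'e) chart"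
    by auto
  then show ?thesis unfolding piecewise_C1_curve_def C1_off_def by auto
qed

text \<open>
  The speed is defined through the chart chosen by \<open>chart_at\<close>, which jumps along the curve.  The
  tensor law makes it computable in whatever chart is convenient.
\<close>

lemma speed_in_chart:
  assumes c: "c \<in> A" "\<gamma> t \<in> fst c" and \<gamma>: "isCont \<gamma> t"
    and w: "(snd c \<circ> \<gamma> has_vector_derivative w) (at t)"
  shows "speed \<gamma> t = sqrt (g c (\<gamma> t) w w)"
proof -
  define d where "d = chart_at A (\<gamma> t)"
  have d: "d \<in> A" "\<gamma> t \<in> fst d" using chart_at by (auto simp: d_def)
  have "\<forall>\<^sub>F u in at t. \<gamma> u \<in> fst c \<inter> fst d"
    using \<gamma> c d by (intro topological_tendstoD open_Int chart_open(1)) (auto simp: isCont_def)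
  then obtain T where T: "open T" "t \<in> T" "\<And>u. u \<in> T \<Longrightarrow> \<gamma> u \<in> fst c \<inter> fst d"
    using c d by (auto simp: eventually_at_topological) (metis)
  have "((snd d \<circ> chart_inv c) \<circ> (snd c \<circ> \<gamma>) has_vector_derivative jacobian c d (\<gamma> t) w) (at t)"
    by (rule vector_derivative_diff_chain_within[OF w has_derivative_at_withinI])
       (use transition_has_derivative[OF c(1) d(1), of "\<gamma> t"] c d in \<open>simp add: comp_def\<close>)
  then have "(snd d \<circ> \<gamma> has_vector_derivative jacobian c d (\<gamma> t) w) (at t)"
    by (rule has_vector_derivative_transform_within_open[OF _ T(1,2)])
       (use T(3) chart_inv_left[OF c(1)] in auto)
  then show ?thesis
    unfolding speed_def tangent_norm_def d_def[symmetric] Let_def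
    using metric_change[OF c(1) d(1)] c d by (simp add: vector_derivative_at)
qed

lemma C1_off_domain_open:
  assumes "C1_off K \<gamma>" "open U" shows "open (({0<..<1} - K) \<inter> \<gamma> -` U)"
  using assms unfolding C1_off_def
  by (intro continuous_open_preimage open_Diff finite_imp_closed)
     (auto intro: continuous_on_subset)

lemma C1_off_isCont:
  assumes "C1_off K \<gamma>" "t \<in> {0<..<1}" shows "isCont \<gamma> t"
proof -
  have "continuous_on {0<..<1} \<gamma>"
    using assms(1) unfolding C1_off_def by (auto intro: continuous_on_subset)
  then show ?thesis using assms(2) by (simp add: continuous_on_eq_continuous_at)
qed

lemma C1_off_velocity:
  assumes "C1_off K \<gamma>" "t \<in> {0<..<1} - K" "c \<in> A" "\<gamma> t \<in> fst c"
  obtains w where "(snd c \<circ> \<gamma> has_vector_derivative w) (at t)" "speed \<gamma> t = sqrt (g c (\<gamma> t) w w)"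
proof -
  have "t \<in> ({0<..<1} - K) \<inter> \<gamma> -` fst c" using assms by simp
  then obtain w where w: "(snd c \<circ> \<gamma> has_vector_derivative w) (at t)"
    using assms(1,3) unfolding C1_off_def C1_differentiable_on_def by metis
  show thesis
    by (rule that[OF w]) (use speed_in_chart[OF assms(3,4) C1_off_isCont[OF assms(1)] w] assms(2) in auto)
qed

lemma speed_nonneg: "speed \<gamma> t \<ge> 0"
  unfolding speed_def tangent_norm_def Let_def by (intro real_sqrt_ge_zero metric_nonneg chart_at)

text \<open>
  Continuity is what makes the speed measurable, so that integrals of it can be added and substituted.
\<close>

lemma speed_cont:
  assumes \<gamma>: "C1_off K \<gamma>" shows "continuous_on ({0<..<1} - K) (speed \<gamma>)"
proof -
  let ?T = "\<lambda>c. ({0<..<1} - K) \<inter> \<gamma> -` fst c"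
  have "continuous_on (?T c) (speed \<gamma>)" if c: "c \<in> A" for c
  proof -
    have "(snd c \<circ> \<gamma>) C1_differentiable_on ?T c" using \<gamma> c by (auto simp: C1_off_def)
    then obtain D where D: "\<And>t. t \<in> ?T c \<Longrightarrow> (snd c \<circ> \<gamma> has_vector_derivative D t) (at t)"
        "continuous_on (?T c) D"
      unfolding C1_differentiable_on_def by blast
    have "continuous_on (?T c) \<gamma>"
      using \<gamma> unfolding C1_off_def by (auto intro: continuous_on_subset)
    then have "continuous_on (?T c) (\<lambda>t. sqrt (g c (\<gamma> t) (D t) (D t)))"
      by (intro continuous_intros metric_cont[OF c] D(2)) auto
    then show ?thesis
      by (rule continuous_on_eq)
         (use speed_in_chart[OF c _ C1_off_isCont[OF \<gamma>] D(1)] in auto)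
  qed
  then have "continuous_on (\<Union>(?T ` A)) (speed \<gamma>)"
    using C1_off_domain_open[OF \<gamma>] chart_open(1) by (intro continuous_on_open_Union) auto
  moreover have "\<Union>(?T ` A) = ({0<..<1} - K) \<inter> \<gamma> -` (\<Union>c\<in>A. fst c)" by auto
  ultimately show ?thesis using chart_cover by simp
qed

lemma speed_measurable:
  assumes "C1_off K \<gamma>"
  shows "(\<lambda>t. indicator ({0<..<1} - K) t * speed \<gamma> t) \<in> borel_measurable borel"
proof -
  have "{0<..<1} - K \<in> sets borel"
    using assms by (intro borel_open open_Diff finite_imp_closed) (auto simp: C1_off_def)
  from borel_measurable_continuous_on_indicator[OF this speed_cont[OF assms]]
  show ?thesis by simp
qed

lemma curve_length_off:
  assumes "finite K"
  shows "curve_length A g \<gamma> = (\<integral>\<^sup>+t. ennreal (indicator ({0<..<1} - K) t * speed \<gamma> t) \<partial>lborel)"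
proof -
  have "insert 0 (insert 1 K) \<in> null_sets lborel"
    using assms by (intro countable_imp_null_set_lborel countable_finite) simp
  then have "AE t in lborel. t \<notin> insert 0 (insert 1 K)" by (rule AE_not_in)
  then show ?thesis
    unfolding curve_length_def speed_def[symmetric]
    by (intro nn_integral_cong_AE, elim eventually_mono) (auto simp: indicator_def)
qed

text \<open>
  Reversal and concatenation of curves are both locally affine reparametrisations \<open>u \<mapsto> \<alpha> u + \<beta>\<close>, with
  \<open>\<alpha> = -1\<close> and \<open>\<alpha> = 2\<close>; this is the common computation behind the symmetry of the distance and the
  triangle inequality.
\<close>

lemma speed_affine:
  assumes \<gamma>: "C1_off K \<gamma>" and J: "open J" "t \<in> J" "\<And>u. u \<in> J \<Longrightarrow> \<eta> u = \<gamma> (\<alpha> * u + \<beta>)"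
    and t: "\<alpha> * t + \<beta> \<in> {0<..<1} - K"
  shows "speed \<eta> t = \<bar>\<alpha>\<bar> * speed \<gamma> (\<alpha> * t + \<beta>)"
proof -
  obtain c where c: "c \<in> A" "\<gamma> (\<alpha> * t + \<beta>) \<in> fst c" using chart_exists .
  obtain w where w: "(snd c \<circ> \<gamma> has_vector_derivative w) (at (\<alpha> * t + \<beta>))"
    and sp: "speed \<gamma> (\<alpha> * t + \<beta>) = sqrt (g c (\<gamma> (\<alpha> * t + \<beta>)) w w)"
    using C1_off_velocity[OF \<gamma> t c] .
  have "((\<lambda>t. \<alpha> * t + \<beta>) has_vector_derivative \<alpha>) (at t)"
    by (auto intro!: derivative_eq_intros simp: has_real_derivative_iff_has_vector_derivative[symmetric])
  from vector_diff_chain_at[OF this w]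
  have w': "(snd c \<circ> \<eta> has_vector_derivative \<alpha> *\<^sub>R w) (at t)"
    by (rule has_vector_derivative_transform_within_open[OF _ J(1,2)]) (simp add: J(3))
  have "isCont (\<lambda>t. \<gamma> (\<alpha> * t + \<beta>)) t"
    by (rule isCont_o2[OF _ C1_off_isCont[OF \<gamma>]]) (use t in \<open>auto intro!: continuous_intros\<close>)
  moreover have "\<forall>\<^sub>F u in nhds t. \<eta> u = \<gamma> (\<alpha> * u + \<beta>)"
    using J eventually_nhds by blast
  ultimately have "isCont \<eta> t" by (simp add: isCont_cong)
  with speed_in_chart[of c \<eta> t, OF c(1) _ _ w'] c sp J(2,3) show ?thesis
    by (simp add: metric_scale real_sqrt_mult)
qed

lemma curve_length_affine:
  assumes \<gamma>: "C1_off K \<gamma>" and "\<alpha> \<noteq> 0"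
    and eq: "\<And>u. \<alpha> * u + \<beta> \<in> {0<..<1} \<Longrightarrow> \<eta> u = \<gamma> (\<alpha> * u + \<beta>)"
  shows "(\<integral>\<^sup>+t. ennreal (indicator ({0<..<1} - K) (\<alpha> * t + \<beta>) * speed \<eta> t) \<partial>lborel)
           = curve_length A g \<gamma>"
proof -
  let ?f = "\<lambda>t. indicator ({0<..<1} - K) t * speed \<gamma> t"
  note [measurable] = speed_measurable[OF \<gamma>]
  have J: "open {u. \<alpha> * u + \<beta> \<in> {0<..<1}}"
    using open_vimage[of "{0<..<1}" "\<lambda>u. \<alpha> * u + \<beta>"] by (simp add: vimage_def continuous_intros)
  have "indicator ({0<..<1} - K) (\<alpha> * t + \<beta>) * speed \<eta> t = \<bar>\<alpha>\<bar> * ?f (\<beta> + \<alpha> * t)" for t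
    using speed_affine[OF \<gamma> J, of t \<eta> \<alpha> \<beta>] eq by (auto simp: indicator_def add.commute)
  then have "(\<integral>\<^sup>+t. ennreal (indicator ({0<..<1} - K) (\<alpha> * t + \<beta>) * speed \<eta> t) \<partial>lborel)
      = (\<integral>\<^sup>+t. \<bar>\<alpha>\<bar> * ennreal (?f (\<beta> + \<alpha> * t)) \<partial>lborel)"
    by (simp add: ennreal_mult speed_nonneg)
  also have "\<dots> = \<bar>\<alpha>\<bar> * (\<integral>\<^sup>+t. ennreal (?f (\<beta> + \<alpha> * t)) \<partial>lborel)"
    by (rule nn_integral_cmult) measurable
  also have "\<dots> = (\<integral>\<^sup>+t. ennreal (?f t) \<partial>lborel)"
    by (rule nn_integral_real_affine[symmetric, OF _ \<open>\<alpha> \<noteq> 0\<close>]) measurable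
  also have "\<dots> = curve_length A g \<gamma>"
    by (rule curve_length_off[symmetric]) (use \<gamma> in \<open>simp add: C1_off_def\<close>)
  finally show ?thesis .
qed

lemma riemannian_dist_le:
  "piecewise_C1_curve A \<gamma> \<Longrightarrow> \<gamma> 0 = q \<Longrightarrow> \<gamma> 1 = r \<Longrightarrow> riemannian_dist A g q r \<le> curve_length A g \<gamma>"
  unfolding riemannian_dist_def by (rule INF_lower) simp

lemma riemannian_dist_self: "riemannian_dist A g q q = 0"
proof -
  have C: "C1_off {} (\<lambda>t. q)" by (auto simp: C1_off_def C1_differentiable_on_def comp_def intro!: exI[of _ "\<lambda>t. 0"])
  have "speed (\<lambda>t. q) t = 0" for t
    using chart_at[of q] bilinear_lzero[OF metric_bilinear[of "chart_at A q" q], of 0]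
    by (simp add: speed_def tangent_norm_def comp_def Let_def)
  then have "curve_length A g (\<lambda>t. q) = 0"
    by (simp add: curve_length_off[of "{}"])
  then show ?thesis
    using riemannian_dist_le[of "\<lambda>t. q" q q] C unfolding piecewise_C1_curve_iff by auto
qed

lemma C1_off_affine:
  assumes \<gamma>: "C1_off K \<gamma>" and T: "open T" "T \<subseteq> {t. \<alpha> * t + \<beta> \<in> {0<..<1} - K}"
    and eq: "\<And>u. u \<in> T \<Longrightarrow> \<eta> u = \<gamma> (\<alpha> * u + \<beta>)" and c: "c \<in> A"
  shows "open (T \<inter> \<eta> -` fst c)" "(snd c \<circ> \<eta>) C1_differentiable_on (T \<inter> \<eta> -` fst c)"
proof -
  have "T \<inter> \<eta> -` fst c = T \<inter> (\<lambda>t. \<alpha> * t + \<beta>) -` (({0<..<1} - K) \<inter> \<gamma> -` fst c)"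
    using T eq by auto
  then show o: "open (T \<inter> \<eta> -` fst c)"
    by (simp only:) (intro open_Int T(1) open_vimage C1_off_domain_open[OF \<gamma> chart_open(1)[OF c]]
        continuous_on_add continuous_on_mult_left continuous_on_id continuous_on_const)
  show "(snd c \<circ> \<eta>) C1_differentiable_on (T \<inter> \<eta> -` fst c)"
  proof (rule C1_differentiable_on_affine[OF _ o])
    show "(snd c \<circ> \<gamma>) C1_differentiable_on (({0<..<1} - K) \<inter> \<gamma> -` fst c)"
      using \<gamma> c by (simp add: C1_off_def)
  qed (use T eq in auto)
qed

lemma riemannian_dist_sym_le: "riemannian_dist A g q r \<le> riemannian_dist A g r q"
proof -
  have "riemannian_dist A g q r \<le> curve_length A g \<gamma>"
    if curve: "piecewise_C1_curve A \<gamma>" "\<gamma> 0 = r" "\<gamma> 1 = q" for \<gamma>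
  proof -
    obtain K where \<gamma>: "C1_off K \<gamma>" using curve(1) unfolding piecewise_C1_curve_iff by auto
    define \<eta> where "\<eta> u = \<gamma> (1 - u)" for u
    let ?K = "(\<lambda>t. 1 - t) ` K"
    have D: "{0<..<1} - ?K = {t. (-1) * t + 1 \<in> {0<..<1} - K}" (is "_ = ?R")
      by (auto intro!: image_eqI[of _ "\<lambda>t. 1 - t"])
    have "finite K" "continuous_on {0..1} \<gamma>" using \<gamma> by (auto simp: C1_off_def)
    have "open ({0<..<1} - ?K)" using \<open>finite K\<close> by (intro open_Diff finite_imp_closed) auto
    from C1_off_affine(2)[OF \<gamma> this, of "-1" 1 \<eta>]
    have "C1_off ?K \<eta>"
      unfolding C1_off_def
      using \<open>finite K\<close> continuous_on_compose2[OF \<open>continuous_on {0..1} \<gamma>\<close>, of "{0..1}" "\<lambda>u. 1 - u"] D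
      by (auto simp: \<eta>_def continuous_intros)
    moreover have "curve_length A g \<eta> = curve_length A g \<gamma>"
    proof -
      have "curve_length A g \<eta> = (\<integral>\<^sup>+t. ennreal (indicator ({0<..<1} - ?K) t * speed \<eta> t) \<partial>lborel)"
        using \<open>finite K\<close> by (intro curve_length_off) simp
      also have "\<dots> = (\<integral>\<^sup>+t. ennreal (indicator ({0<..<1} - K) ((-1) * t + 1) * speed \<eta> t) \<partial>lborel)"
        unfolding D by (simp add: indicator_def)
      also have "\<dots> = curve_length A g \<gamma>"
        by (rule curve_length_affine[OF \<gamma>]) (auto simp: \<eta>_def)
      finally show ?thesis .
    qed
    ultimately show ?thesis
      using riemannian_dist_le[of \<eta> q r] curve(2,3) unfolding piecewise_C1_curve_iff
      by (auto simp: \<eta>_def)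
  qed
  then show ?thesis unfolding riemannian_dist_def[of A g r q] by (intro INF_greatest) auto
qed

lemma riemannian_dist_sym: "riemannian_dist A g q r = riemannian_dist A g r q"
  using riemannian_dist_sym_le by (intro antisym)

lemma curve_join:
  assumes "piecewise_C1_curve A \<gamma>\<^sub>1" "piecewise_C1_curve A \<gamma>\<^sub>2" "\<gamma>\<^sub>1 1 = \<gamma>\<^sub>2 0"
  shows "piecewise_C1_curve A (\<gamma>\<^sub>1 +++ \<gamma>\<^sub>2)"
    and "curve_length A g (\<gamma>\<^sub>1 +++ \<gamma>\<^sub>2) = curve_length A g \<gamma>\<^sub>1 + curve_length A g \<gamma>\<^sub>2"
proof -
  obtain K1 K2 where K: "C1_off K1 \<gamma>\<^sub>1" "C1_off K2 \<gamma>\<^sub>2"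
    using assms(1,2) unfolding piecewise_C1_curve_iff by auto
  let ?\<eta> = "\<gamma>\<^sub>1 +++ \<gamma>\<^sub>2"
  let ?T1 = "{t. 2 * t + 0 \<in> {0<..<1} - K1}" and ?T2 = "{t. 2 * t + (-1) \<in> {0<..<1} - K2}"
  \<comment> \<open>Only the exceptional parameters inside the unit interval are transported: a point of \<open>K1\<close>
      outside it could land in the half of the interval that belongs to the other curve.\<close>
  define K' where "K' = insert (1/2) ((\<lambda>t. t / 2) ` (K1 \<inter> {0<..<1}) \<union> (\<lambda>t. (t + 1) / 2) ` (K2 \<inter> {0<..<1}))"
  have fin: "finite K1" "finite K2" using K by (auto simp: C1_off_def)
  have fin': "finite K'" using fin by (simp add: K'_def)
  have D1: "t \<in> (\<lambda>t. t / 2) ` K \<longleftrightarrow> 2 * t \<in> K" for t and K :: "real set"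
    by (auto intro!: image_eqI[of _ "\<lambda>t. t / 2" "2 * t"])
  have D2: "t \<in> (\<lambda>t. (t + 1) / 2) ` K \<longleftrightarrow> 2 * t - 1 \<in> K" for t and K :: "real set"
  proof
    assume "t \<in> (\<lambda>t. (t + 1) / 2) ` K"
    then obtain s where s: "s \<in> K" "t = (s + 1) / 2" by blast
    then have "2 * t - 1 = s" by simp
    with s show "2 * t - 1 \<in> K" by (simp only:)
  qed (rule image_eqI[of _ _ "2 * t - 1"], simp_all)
  have D: "{0<..<1} - K' \<subseteq> ?T1 \<union> ?T2" by (auto simp: K'_def D1 D2)
  have e1: "?\<eta> t = \<gamma>\<^sub>1 (2 * t + 0)" if "t \<in> {t. 2 * t + 0 \<in> {0<..<1}}" for t
    using that by (simp add: joinpaths_def)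
  have e2: "?\<eta> t = \<gamma>\<^sub>2 (2 * t + (-1))" if "t \<in> {t. 2 * t + (-1) \<in> {0<..<1}}" for t
    using that by (simp add: joinpaths_def)
  have o1: "open ?T1" using fin
    open_vimage[of "{0<..<1} - K1" "\<lambda>t. 2 * t + 0"] by (simp add: vimage_def continuous_intros open_Diff finite_imp_closed)
  have o2: "open ?T2" using fin
    open_vimage[of "{0<..<1} - K2" "\<lambda>t. 2 * t + (-1)"] by (simp add: vimage_def continuous_intros open_Diff finite_imp_closed)
  have path: "continuous_on {0..1} ?\<eta>"
    using path_join_imp[of \<gamma>\<^sub>1 \<gamma>\<^sub>2] K assms(3) by (simp add: path_def pathfinish_def pathstart_def C1_off_def)
  have C: "C1_off K' ?\<eta>" unfolding C1_off_def
  proof (intro conjI ballI fin' path)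
    fix c assume c: "c \<in> A"
    have *: "(snd c \<circ> ?\<eta>) C1_differentiable_on (?T1 \<inter> ?\<eta> -` fst c \<union> ?T2 \<inter> ?\<eta> -` fst c)"
      using C1_off_affine[OF K(1) o1 _ _ c, of 2 0 ?\<eta>] C1_off_affine[OF K(2) o2 _ _ c, of 2 "-1" ?\<eta>] e1 e2
      by (intro C1_differentiable_on_open_Un) auto
    show "(snd c \<circ> ?\<eta>) C1_differentiable_on (({0<..<1} - K') \<inter> ?\<eta> -` fst c)"
      by (rule C1_differentiable_on_subset[OF *]) (use D in auto)
  qed
  then show "piecewise_C1_curve A ?\<eta>" unfolding piecewise_C1_curve_iff by auto
  let ?s = "\<lambda>t. speed ?\<eta> t"
  have "curve_length A g ?\<eta> = (\<integral>\<^sup>+t. ennreal (indicator ({0<..<1} - K') t * ?s t) \<partial>lborel)"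
    by (rule curve_length_off[OF fin'])
  also have "\<dots> = (\<integral>\<^sup>+t. ennreal (indicator ?T1 t * ?s t) + ennreal (indicator ?T2 t * ?s t) \<partial>lborel)"
  proof (rule nn_integral_cong)
    fix t
    have *: "t \<in> {0<..<1} - K' \<longleftrightarrow> t \<in> ?T1 \<or> t \<in> ?T2"
      by (auto simp: K'_def D1 D2)
    show "ennreal (indicator ({0<..<1} - K') t * ?s t)
        = ennreal (indicator ?T1 t * ?s t) + ennreal (indicator ?T2 t * ?s t)"
      unfolding indicator_def * by auto
  qed
  also have "\<dots> = (\<integral>\<^sup>+t. ennreal (indicator ?T1 t * ?s t) \<partial>lborel) + (\<integral>\<^sup>+t. ennreal (indicator ?T2 t * ?s t) \<partial>lborel)"
  proof (rule nn_integral_add)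
    have *: "(\<lambda>t. indicator T t * (indicator ({0<..<1} - K') t * ?s t)) \<in> borel_measurable borel"
      if "open T" for T
      using that by (intro borel_measurable_times speed_measurable[OF C] borel_measurable_indicator borel_open)
    have e: "indicator ?T1 t * (indicator ({0<..<1} - K') t * ?s t) = indicator ?T1 t * ?s t"
      "indicator ?T2 t * (indicator ({0<..<1} - K') t * ?s t) = indicator ?T2 t * ?s t" for t
      by (auto simp: indicator_def K'_def D1 D2)
    note [measurable] = *[OF o1, unfolded e] *[OF o2, unfolded e]
    show "(\<lambda>t. ennreal (indicator ?T1 t * ?s t)) \<in> borel_measurable lborel"
      "(\<lambda>t. ennreal (indicator ?T2 t * ?s t)) \<in> borel_measurable lborel"
      by measurable
  qed
  also have "\<dots> = curve_length A g \<gamma>\<^sub>1 + curve_length A g \<gamma>\<^sub>2"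
    using curve_length_affine[OF K(1), of 2 0 ?\<eta>] curve_length_affine[OF K(2), of 2 "-1" ?\<eta>] e1 e2
    by (simp add: indicator_def)
  finally show "curve_length A g ?\<eta> = curve_length A g \<gamma>\<^sub>1 + curve_length A g \<gamma>\<^sub>2" .
qed

lemma riemannian_dist_triangle:
  "riemannian_dist A g q s \<le> riemannian_dist A g q r + riemannian_dist A g r s"
proof -
  \<comment> \<open>An infimum of extended reals is approached strictly from above only if it is finite, hence
      the case distinction.\<close>
  have *: "a \<le> (INF i\<in>I. f i) + c" if le: "\<And>i. i \<in> I \<Longrightarrow> a \<le> f i + c"
    for a c :: ennreal and f :: "(real \<Rightarrow> 'm) \<Rightarrow> ennreal" and I
  proof (cases "(INF i\<in>I. f i) = top")
    case False
    show ?thesis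
    proof (rule ennreal_le_epsilon)
      fix e :: real assume "0 < e"
      then have "(INF i\<in>I. f i) < (INF i\<in>I. f i) + ennreal e"
        using False by (cases "INF i\<in>I. f i") (auto simp flip: ennreal_plus simp: ennreal_lessI)
      then obtain i where "i \<in> I" "f i < (INF i\<in>I. f i) + ennreal e" by (auto simp: INF_less_iff)
      then have "a \<le> (INF i\<in>I. f i) + ennreal e + c"
        using le[of i] by (meson add_right_mono less_imp_le order_trans)
      then show "a \<le> (INF i\<in>I. f i) + c + ennreal e" by (simp add: ac_simps)
    qed
  qed simp
  have "riemannian_dist A g q s \<le> curve_length A g \<gamma>\<^sub>1 + curve_length A g \<gamma>\<^sub>2"
    if "\<gamma>\<^sub>1 \<in> {\<gamma>. piecewise_C1_curve A \<gamma> \<and> \<gamma> 0 = q \<and> \<gamma> 1 = r}"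
      "\<gamma>\<^sub>2 \<in> {\<gamma>. piecewise_C1_curve A \<gamma> \<and> \<gamma> 0 = r \<and> \<gamma> 1 = s}" for \<gamma>\<^sub>1 \<gamma>\<^sub>2
    using that curve_join[of \<gamma>\<^sub>1 \<gamma>\<^sub>2] riemannian_dist_le[of "\<gamma>\<^sub>1 +++ \<gamma>\<^sub>2" q s]
    by (auto simp: joinpaths_def)
  then have "riemannian_dist A g q s \<le> riemannian_dist A g q r + curve_length A g \<gamma>\<^sub>2"
    if "\<gamma>\<^sub>2 \<in> {\<gamma>. piecewise_C1_curve A \<gamma> \<and> \<gamma> 0 = r \<and> \<gamma> 1 = s}" for \<gamma>\<^sub>2
    unfolding riemannian_dist_def[of A g q r] using that by (intro *) blast
  then have "riemannian_dist A g q s \<le> curve_length A g \<gamma>\<^sub>2 + riemannian_dist A g q r"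
    if "\<gamma>\<^sub>2 \<in> {\<gamma>. piecewise_C1_curve A \<gamma> \<and> \<gamma> 0 = r \<and> \<gamma> 1 = s}" for \<gamma>\<^sub>2
    using that by (subst add.commute) blast
  then have "riemannian_dist A g q s \<le> riemannian_dist A g r s + riemannian_dist A g q r"
    unfolding riemannian_dist_def[of A g r s] by (intro *) blast
  then show ?thesis by (subst add.commute)
qed

end

section \<open>The Riemannian distance and the manifold topology\<close>

lemma has_real_derivative_positive_part_squared:
  "((\<lambda>u::real. (max 0 u)\<^sup>2) has_real_derivative 2 * max 0 u) (at u)"
proof (cases u "0::real" rule: linorder_cases)
  case less
  have "((\<lambda>u. 0) has_real_derivative 0) (at u)" by simp
  then have "((\<lambda>u::real. (max 0 u)\<^sup>2) has_real_derivative 0) (at u)"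
    by (rule has_field_derivative_transform_within_open[of _ _ _ "{..<0}"]) (use less in auto)
  then show ?thesis using less by simp
next
  case greater
  have "((\<lambda>u. u\<^sup>2) has_real_derivative 2 * u) (at u)" by (auto intro!: derivative_eq_intros)
  then have "((\<lambda>u::real. (max 0 u)\<^sup>2) has_real_derivative 2 * u) (at u)"
    by (rule has_field_derivative_transform_within_open[of _ _ _ "{0<..}"]) (use greater in auto)
  then show ?thesis using greater by simp
next
  case equal
  have "((\<lambda>h::real. ((max 0 (0 + h))\<^sup>2 - (max 0 0)\<^sup>2) / h) \<longlongrightarrow> 0) (at 0)"
  proof (rule Lim_null_comparison)
    show "\<forall>\<^sub>F h in at 0. norm (((max 0 (0 + h))\<^sup>2 - (max 0 (0::real))\<^sup>2) / h) \<le> \<bar>h\<bar>"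
      by (intro always_eventually allI) (auto simp: max_def power2_eq_square)
    show "((\<lambda>h::real. \<bar>h\<bar>) \<longlongrightarrow> 0) (at 0)"
      by (rule tendsto_rabs_zero) (rule tendsto_ident_at)
  qed
  then show ?thesis using equal by (simp add: DERIV_def)
qed

context riemannian_manifold
begin

text \<open>
  The chain rule bounds the derivative of \<open>F \<circ> \<gamma>\<close> by \<open>L\<close> times the speed away from finitely many
  parameters, and the fundamental theorem of calculus tolerates finitely many exceptions.  The gradient
  bound is required in one chart around each point only, so that it can be verified in the chart in
  which \<open>F\<close> is given.
\<close>

lemma lipschitz_along_curve:
  fixes F :: "'m \<Rightarrow> real"
  assumes "L > 0" and F: "continuous_on UNIV F"
    and grad: "\<And>q. \<exists>c\<in>A. q \<in> fst c \<and>
       (\<exists>F'. (F \<circ> chart_inv c has_derivative F') (at (snd c q)) \<and> (\<forall>v. \<bar>F' v\<bar> \<le> L * sqrt (g c q v v)))"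
    and \<gamma>: "piecewise_C1_curve A \<gamma>"
  shows "ennreal \<bar>F (\<gamma> 1) - F (\<gamma> 0)\<bar> \<le> ennreal L * curve_length A g \<gamma>"
proof (cases "curve_length A g \<gamma> = top")
  case True then show ?thesis using \<open>L > 0\<close> by (simp add: ennreal_mult_top)
next
  case False
  obtain K where K: "C1_off K \<gamma>" using \<gamma> unfolding piecewise_C1_curve_iff by auto
  then have fin: "finite K" and co: "continuous_on {0..1} \<gamma>" by (auto simp: C1_off_def)
  define S where "S t = indicator ({0<..<1} - K) t * speed \<gamma> t" for t
  obtain r where r: "curve_length A g \<gamma> = ennreal r" "r \<ge> 0"
    using False by (cases "curve_length A g \<gamma>") auto
  have S: "(S has_integral r) {0..1}"
  proof -
    have "(S has_integral r) UNIV"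
      using speed_measurable[OF K] curve_length_off[OF fin, of \<gamma>] r speed_nonneg
      by (intro nn_integral_has_integral) (auto simp: S_def[abs_def])
    moreover have "S = (\<lambda>t. if t \<in> {0..1} then S t else 0)" by (auto simp: S_def indicator_def fun_eq_iff)
    ultimately show ?thesis using has_integral_restrict_UNIV[of "{0..1}" S] by simp
  qed
  have ex: "\<exists>D. (F \<circ> \<gamma> has_vector_derivative D) (at t) \<and> \<bar>D\<bar> \<le> L * speed \<gamma> t"
    if t: "t \<in> {0<..<1} - K" for t
  proof -
    obtain c F' where c: "c \<in> A" "\<gamma> t \<in> fst c"
      and F': "(F \<circ> chart_inv c has_derivative F') (at (snd c (\<gamma> t)))"
        "\<And>v. \<bar>F' v\<bar> \<le> L * sqrt (g c (\<gamma> t) v v)"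
      using grad[of "\<gamma> t"] by auto
    obtain w where w: "(snd c \<circ> \<gamma> has_vector_derivative w) (at t)" "speed \<gamma> t = sqrt (g c (\<gamma> t) w w)"
      using C1_off_velocity[OF K t c] .
    have "((F \<circ> chart_inv c) \<circ> (snd c \<circ> \<gamma>) has_vector_derivative F' w) (at t)"
      by (rule vector_derivative_diff_chain_within[OF w(1) has_derivative_at_withinI])
         (use F' in \<open>simp add: comp_def\<close>)
    then have "(F \<circ> \<gamma> has_vector_derivative F' w) (at t)"
      by (rule has_vector_derivative_transform_within_open[OF _ C1_off_domain_open[OF K chart_open(1)[OF c(1)]]])
         (use t c chart_inv_left[OF c(1)] in auto)
    then show ?thesis using F'(2)[of w] w(2) by auto
  qed
  \<comment> \<open>The value 0 at the exceptional parameters makes the bound \<open>\<bar>D t\<bar> \<le> L * S t\<close> hold everywhere.\<close>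
  define D where "D t = (if t \<in> {0<..<1} - K
      then SOME D. (F \<circ> \<gamma> has_vector_derivative D) (at t) \<and> \<bar>D\<bar> \<le> L * speed \<gamma> t else 0)" for t
  have D: "(F \<circ> \<gamma> has_vector_derivative D t) (at t) \<and> \<bar>D t\<bar> \<le> L * speed \<gamma> t"
    if "t \<in> {0<..<1} - K" for t
    using someI_ex[OF ex[OF that]] that by (simp add: D_def)
  have D_int: "(D has_integral ((F \<circ> \<gamma>) 1 - (F \<circ> \<gamma>) 0)) {0..1}"
    by (rule fundamental_theorem_of_calculus_interior_strong[OF fin])
       (use D continuous_on_compose2[OF F co] in \<open>auto simp: comp_def\<close>)
  have LS: "((\<lambda>t. L * S t) has_integral (L * r)) {0..1}" using S by (rule has_integral_mult_right)
  have le: "\<bar>D t\<bar> \<le> L * S t" for t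
    using D[of t] by (cases "t \<in> {0<..<1} - K") (auto simp: S_def D_def)
  have "(F \<circ> \<gamma>) 1 - (F \<circ> \<gamma>) 0 \<le> L * r"
    by (rule has_integral_le[OF D_int LS]) (use le in \<open>auto simp: abs_le_iff\<close>)
  moreover have "- ((F \<circ> \<gamma>) 1 - (F \<circ> \<gamma>) 0) \<le> L * r"
    by (rule has_integral_le[OF has_integral_neg[OF D_int] LS]) (use le in \<open>auto simp: abs_le_iff\<close>)
  ultimately have "\<bar>F (\<gamma> 1) - F (\<gamma> 0)\<bar> \<le> L * r" by (simp add: abs_le_iff)
  then show ?thesis using r \<open>L > 0\<close> by (simp add: ennreal_mult[symmetric] ennreal_leI)
qed

text \<open>
  A function on coordinate space that is constant off a closed ball inside the chart image extends to
  the whole manifold: the ball corresponds to a compact, hence closed, set, and its complement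
  and the chart domain form an open cover.
\<close>

lemma extend_by_constant:
  fixes \<rho> :: "'e \<Rightarrow> real"
  assumes c: "c \<in> A" and B: "cball y\<^sub>0 r \<subseteq> snd c ` fst c"
    and \<rho>: "continuous_on UNIV \<rho>" "\<And>y. y \<notin> cball y\<^sub>0 r \<Longrightarrow> \<rho> y = k"
  defines "F \<equiv> \<lambda>q. if q \<in> fst c then \<rho> (snd c q) else k"
  shows "continuous_on UNIV F" and "closed (chart_inv c ` cball y\<^sub>0 r)"
    and "\<And>q. q \<notin> chart_inv c ` cball y\<^sub>0 r \<Longrightarrow> F q = k"
proof -
  let ?C = "chart_inv c ` cball y\<^sub>0 r"
  have "compact ?C"
    by (intro compact_continuous_image continuous_on_subset[OF chart_inv_cont[OF c] B]) simp
  then show C: "closed ?C" by (rule compact_imp_closed)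
  show k: "F q = k" if "q \<notin> ?C" for q
  proof (cases "q \<in> fst c")
    case True
    have "snd c q \<notin> cball y\<^sub>0 r"
    proof
      assume "snd c q \<in> cball y\<^sub>0 r"
      then have "chart_inv c (snd c q) \<in> ?C" by (rule imageI)
      then show False using that chart_inv_left[OF c True] by simp
    qed
    then show ?thesis using \<rho>(2) True by (simp add: F_def)
  qed (simp add: F_def)
  have "continuous_on (fst c) F"
    by (rule continuous_on_eq[OF continuous_on_compose2[OF \<rho>(1) chart_cont[OF c]]]) (auto simp: F_def)
  moreover have "continuous_on (- ?C) F"
    by (rule continuous_on_eq[OF continuous_on_const[of _ k]]) (use k in auto)
  ultimately have "continuous_on (fst c \<union> - ?C) F"
    using C chart_open(1)[OF c] by (intro continuous_on_open_Un) auto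
  moreover have "fst c \<union> - ?C = UNIV"
    using B chart_inv_in[OF c] by auto
  ultimately show "continuous_on UNIV F" by simp
qed

text \<open>
  Let \<open>F\<close> be the bump function
  \<open>max(0, r\<^sup>2 - |y - y\<^sub>0|\<^sup>2)\<^sup>2\<close> in a coordinate ball inside \<open>U\<close>.  It is differentiable, and on the compact
  ball its gradient is bounded, so it is Lipschitz for the distance.  Since \<open>F q = r\<^sup>4\<close>, a point at distance
  less than \<open>r\<^sup>4 / L\<close> has \<open>F > 0\<close> and lies in the ball.
\<close>

lemma riemannian_dist_topology:
  assumes U: "open U" "q \<in> U"
  obtains \<epsilon> :: real where "\<epsilon> > 0" "\<And>p. riemannian_dist A g p q < ennreal \<epsilon> \<Longrightarrow> p \<in> U"
proof -
  obtain c where c: "c \<in> A" "q \<in> fst c" using chart_exists .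
  define y\<^sub>0 where "y\<^sub>0 = snd c q"
  have "y\<^sub>0 \<in> snd c ` (fst c \<inter> U)" using c U by (auto simp: y\<^sub>0_def)
  then obtain r where r: "r > 0" "cball y\<^sub>0 r \<subseteq> snd c ` (fst c \<inter> U)"
    using chart_image_open[OF c(1) U(1)] open_contains_cball by metis
  then have B: "cball y\<^sub>0 r \<subseteq> snd c ` fst c" by auto
  obtain a b where ab: "a > 0" "\<And>y v. y \<in> cball y\<^sub>0 r \<Longrightarrow> a * norm v \<le> sqrt (g c (chart_inv c y) v v)"
    using metric_comparable_on_compact[OF c(1) compact_cball B] by metis
  define \<rho> where "\<rho> y = (max 0 (r\<^sup>2 - (y - y\<^sub>0) \<bullet> (y - y\<^sub>0)))\<^sup>2" for y
  define \<rho>' where "\<rho>' y v = 2 * max 0 (r\<^sup>2 - (y - y\<^sub>0) \<bullet> (y - y\<^sub>0)) * - (2 * ((y - y\<^sub>0) \<bullet> v))" for y v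
  have \<rho>': "(\<rho> has_derivative \<rho>' y) (at y)" for y
  proof -
    have "((\<lambda>y. r\<^sup>2 - (y - y\<^sub>0) \<bullet> (y - y\<^sub>0)) has_derivative (\<lambda>v. - (2 * ((y - y\<^sub>0) \<bullet> v)))) (at y)"
      by (auto intro!: derivative_eq_intros simp: inner_commute)
    from diff_chain_at[OF this has_field_derivative_imp_has_derivative[OF has_real_derivative_positive_part_squared]]
    show ?thesis by (simp add: \<rho>_def[abs_def] \<rho>'_def[abs_def] comp_def)
  qed
  have \<rho>_cont: "continuous_on UNIV \<rho>" by (auto simp: \<rho>_def[abs_def] intro!: continuous_intros)
  have out: "r\<^sup>2 - (y - y\<^sub>0) \<bullet> (y - y\<^sub>0) \<le> 0" if "y \<notin> cball y\<^sub>0 r" for y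
  proof -
    have "r \<le> norm (y - y\<^sub>0)" using that by (simp add: dist_norm norm_minus_commute)
    then have "r\<^sup>2 \<le> (norm (y - y\<^sub>0))\<^sup>2" using r(1) by (intro power_mono) auto
    then show ?thesis by (simp add: power2_norm_eq_inner)
  qed
  have \<rho>_out: "\<rho> y = 0" if "y \<notin> cball y\<^sub>0 r" for y using out[OF that] by (simp add: \<rho>_def max.absorb1)
  define F where "F p = (if p \<in> fst c then \<rho> (snd c p) else 0)" for p
  note ext = extend_by_constant[OF c(1) B \<rho>_cont \<rho>_out, folded F_def[abs_def], folded F_def]
  let ?C = "chart_inv c ` cball y\<^sub>0 r"
  \<comment> \<open>The Euclidean gradient of \<open>\<rho>\<close> has norm \<open>4 * (r\<^sup>2 - |z|\<^sup>2) * |z| \<le> 4 * r ^ 3\<close> for \<open>z = y - y\<^sub>0\<close> in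
      the ball; the factor \<open>1 / a\<close> converts to the Riemannian norm.\<close>
  define L where "L = 4 * r ^ 3 / a"
  have L: "L > 0" using r ab by (simp add: L_def)
  have grad: "\<exists>d\<in>A. p \<in> fst d \<and> (\<exists>F'. (F \<circ> chart_inv d has_derivative F') (at (snd d p)) \<and>
      (\<forall>v. \<bar>F' v\<bar> \<le> L * sqrt (g d p v v)))" for p
  proof (cases "p \<in> fst c")
    case True
    have "(F \<circ> chart_inv c has_derivative \<rho>' (snd c p)) (at (snd c p))"
      by (rule has_derivative_transform_within_open[OF \<rho>' chart_open(2)[OF c(1)]])
         (use True chart_inv_left[OF c(1)] in \<open>auto simp: F_def\<close>)
    moreover have "\<bar>\<rho>' (snd c p) v\<bar> \<le> L * sqrt (g c p v v)" for v
    proof (cases "snd c p \<in> cball y\<^sub>0 r")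
      case in_ball: True
      let ?z = "snd c p - y\<^sub>0"
      have z: "norm ?z \<le> r" using in_ball by (simp add: dist_norm norm_minus_commute)
      have "\<bar>\<rho>' (snd c p) v\<bar> = 4 * (max 0 (r\<^sup>2 - ?z \<bullet> ?z) * \<bar>?z \<bullet> v\<bar>)"
        by (simp add: \<rho>'_def abs_mult)
      also have "\<dots> \<le> 4 * (r\<^sup>2 * (r * norm v))"
        using z r(1) Cauchy_Schwarz_ineq2[of ?z v] mult_right_mono[OF z, of "norm v"]
        by (intro mult_left_mono mult_mono) auto
      also have "\<dots> = L * (a * norm v)" using ab by (simp add: L_def power3_eq_cube power2_eq_square)
      also have "\<dots> \<le> L * sqrt (g c p v v)"
        using ab(2)[OF in_ball, of v] L chart_inv_left[OF c(1) True] by (intro mult_left_mono) auto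
      finally show ?thesis .
    next
      case False
      then show ?thesis using out[OF False] L metric_nonneg[OF c(1) True] by (simp add: \<rho>'_def max_def)
    qed
    ultimately show ?thesis using c True by blast
  next
    case False
    obtain d where d: "d \<in> A" "p \<in> fst d" using chart_exists .
    have "p \<notin> ?C" using False B chart_inv_in[OF c(1)] by auto
    have "open (snd d ` (fst d \<inter> - ?C))" using chart_image_open[OF d(1)] ext(2) by blast
    then have "(F \<circ> chart_inv d has_derivative (\<lambda>v. 0)) (at (snd d p))"
      by (rule has_derivative_transform_within_open[OF has_derivative_const[of 0]])
         (use d \<open>p \<notin> ?C\<close> chart_inv_left[OF d(1)] ext(3) in auto)
    then show ?thesis using d L metric_nonneg[OF d] by (intro bexI[of _ d]) auto
  qed
  have Fq: "F q = r ^ 4" using c r by (simp add: F_def \<rho>_def y\<^sub>0_def)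
  show thesis
  proof (rule that[of "r ^ 4 / L"])
    show "r ^ 4 / L > 0" using r L by simp
    fix p assume "riemannian_dist A g p q < ennreal (r ^ 4 / L)"
    then obtain \<gamma> where \<gamma>: "piecewise_C1_curve A \<gamma>" "\<gamma> 0 = p" "\<gamma> 1 = q"
      "curve_length A g \<gamma> < ennreal (r ^ 4 / L)"
      unfolding riemannian_dist_def by (auto simp: INF_less_iff)
    have "ennreal \<bar>F q - F p\<bar> \<le> ennreal L * curve_length A g \<gamma>"
      using lipschitz_along_curve[OF L ext(1) grad \<gamma>(1)] \<gamma> by simp
    also have "\<dots> < ennreal L * ennreal (r ^ 4 / L)"
      using \<gamma>(4) L by (intro ennreal_mult_strict_left_mono) auto
    also have "\<dots> = ennreal (r ^ 4)" using L r by (simp add: ennreal_mult[symmetric])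
    finally have "F p > 0" using Fq r by (simp add: ennreal_less_iff)
    then have "p \<in> ?C" using ext(3)[of p] by auto
    then obtain y where "y \<in> cball y\<^sub>0 r" "p = chart_inv c y" by auto
    then show "p \<in> U" using r(2) chart_inv_left[OF c(1)] by auto
  qed
qed

section \<open>Almost critical points on complete manifolds\<close>

lemma straight_line_C1_off:
  assumes c: "c \<in> A" and seg: "\<And>u. u \<in> {0..1} \<Longrightarrow> y + u *\<^sub>R w \<in> snd c ` fst c"
  shows "C1_off {} (\<lambda>u. chart_inv c (y + u *\<^sub>R w))" (is "C1_off {} ?\<gamma>")
  unfolding C1_off_def
proof (intro conjI ballI)
  show cont: "continuous_on {0..1} ?\<gamma>"
    by (rule continuous_on_compose2[OF chart_inv_cont[OF c]]) (use seg in \<open>auto intro!: continuous_intros\<close>)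
  fix d assume d: "d \<in> A"
  let ?S = "snd c ` (fst c \<inter> fst d)" and ?\<tau> = "snd d \<circ> chart_inv c"
  let ?D = "\<lambda>z. frechet_derivative ?\<tau> (at z within ?S)"
  have oS: "open ?S" by (rule chart_image_open[OF c chart_open(1)[OF d]])
  have "Ck_on (Suc 0) ?S ?\<tau>"
    using transition_smooth[OF c d] by (simp only: smooth_on_def)
  then have diff: "?\<tau> differentiable_on ?S" and co: "continuous_on ?S (\<lambda>z. ?D z w)" by auto
  let ?T = "({0<..<1} - {}) \<inter> ?\<gamma> -` fst d"
  have in_S: "y + u *\<^sub>R w \<in> ?S" if "u \<in> ?T" for u
  proof -
    have "y + u *\<^sub>R w \<in> snd c ` fst c" using that by (intro seg) auto
    then show ?thesis
      using that chart_inv_in[OF c] chart_inv_right[OF c] by (intro image_eqI[of _ _ "?\<gamma> u"]) auto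
  qed
  have "(snd d \<circ> ?\<gamma> has_vector_derivative ?D (y + u *\<^sub>R w) w) (at u)" if "u \<in> ?T" for u
  proof -
    have l: "((\<lambda>u. y + u *\<^sub>R w) has_vector_derivative w) (at u)"
      by (auto intro!: derivative_eq_intros simp: has_vector_derivative_def)
    have "(?\<tau> has_derivative ?D (y + u *\<^sub>R w)) (at (y + u *\<^sub>R w) within ?S)"
      using bspec[OF diff[unfolded differentiable_on_def] in_S[OF that]]
      unfolding frechet_derivative_works .
    then have "(?\<tau> has_derivative ?D (y + u *\<^sub>R w)) (at (y + u *\<^sub>R w))"
      unfolding at_within_open[OF in_S[OF that] oS] .
    then have "(?\<tau> \<circ> (\<lambda>u. y + u *\<^sub>R w) has_vector_derivative ?D (y + u *\<^sub>R w) w) (at u)"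
      by (rule vector_derivative_diff_chain_within[OF l has_derivative_at_withinI])
    then show ?thesis by (simp add: comp_def)
  qed
  moreover have "continuous_on ?T (\<lambda>u. ?D (y + u *\<^sub>R w) w)"
    by (rule continuous_on_compose2[OF co, of ?T "\<lambda>u. y + u *\<^sub>R w"])
       (use in_S in \<open>auto intro!: continuous_intros\<close>)
  ultimately show "(snd d \<circ> ?\<gamma>) C1_differentiable_on ?T"
    unfolding C1_differentiable_on_def
    by (intro exI[of _ "\<lambda>u. ?D (y + u *\<^sub>R w) w"] conjI ballI)
qed simp

lemma dist_straight_line:
  assumes c: "c \<in> A" and seg: "\<And>u. u \<in> {0..1} \<Longrightarrow> y + u *\<^sub>R w \<in> snd c ` fst c"
    and le: "\<And>u. u \<in> {0..1} \<Longrightarrow> sqrt (g c (chart_inv c (y + u *\<^sub>R w)) w w) \<le> \<kappa>"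
  shows "riemannian_dist A g (chart_inv c y) (chart_inv c (y + w)) \<le> ennreal \<kappa>"
proof -
  define \<gamma> where "\<gamma> u = chart_inv c (y + u *\<^sub>R w)" for u
  have C: "C1_off {} \<gamma>" unfolding \<gamma>_def[abs_def] by (rule straight_line_C1_off[OF c seg])
  have sp: "speed \<gamma> u \<le> \<kappa>" if u: "u \<in> {0<..<1}" for u
  proof -
    have in_c: "\<gamma> u \<in> fst c" using u unfolding \<gamma>_def by (intro chart_inv_in[OF c] seg) auto
    have "((\<lambda>u. y + u *\<^sub>R w) has_vector_derivative w) (at u)"
      by (auto intro!: derivative_eq_intros simp: has_vector_derivative_def)
    then have "(snd c \<circ> \<gamma> has_vector_derivative w) (at u)"
      by (rule has_vector_derivative_transform_within_open[of _ _ _ "{0<..<1}"])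
         (use u in \<open>auto simp: \<gamma>_def chart_inv_right[OF c seg]\<close>)
    from speed_in_chart[OF c in_c C1_off_isCont[OF C u] this] show ?thesis
      using le[of u] u by (simp add: \<gamma>_def)
  qed
  have "riemannian_dist A g (chart_inv c y) (chart_inv c (y + w)) \<le> curve_length A g \<gamma>"
    using C unfolding \<gamma>_def by (intro riemannian_dist_le) (auto simp: piecewise_C1_curve_iff)
  also have "\<dots> = (\<integral>\<^sup>+u. ennreal (indicator ({0<..<1} - {}) u * speed \<gamma> u) \<partial>lborel)"
    by (rule curve_length_off) simp
  also have "\<dots> \<le> (\<integral>\<^sup>+u. ennreal \<kappa> * indicator {0<..<1::real} u \<partial>lborel)"
    by (rule nn_integral_mono) (use sp in \<open>auto simp: indicator_def ennreal_leI\<close>)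
  also have "\<dots> = ennreal \<kappa>" by (simp add: nn_integral_cmult)
  finally show ?thesis .
qed

text \<open>
  If \<open>F\<close> decreases in the direction \<open>v\<close> at a rate larger than \<open>1 / C\<close> per unit length, then it does so on
  a short coordinate segment too: the drop is controlled by the derivative at \<open>q\<close>, the length by the
  continuity of the metric.  The slack between the two is split at \<open>\<kappa>\<close>.
\<close>

lemma descent_step:
  fixes F :: "'m \<Rightarrow> real"
  assumes c: "c \<in> A" "q \<in> fst c"
    and F': "(F \<circ> chart_inv c has_derivative F') (at (snd c q))"
    and "C > 0" and steep: "sqrt (g c q v v) < - C * F' v"
  shows "\<exists>p. F p < F q \<and> riemannian_dist A g q p \<le> ennreal (C * (F q - F p))"
proof -
  let ?l = "\<lambda>\<tau>. snd c q + \<tau> *\<^sub>R v" and ?Y = "snd c ` fst c"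
  obtain \<kappa> where \<kappa>: "sqrt (g c q v v) < \<kappa>" "\<kappa> < - C * F' v" using dense[OF steep] by blast
  have "\<kappa> > 0" using \<kappa>(1) metric_nonneg[OF c] by (meson le_less_trans real_sqrt_ge_zero)
  have "((F \<circ> chart_inv c) \<circ> ?l has_vector_derivative F' v) (at 0)"
  proof (rule vector_derivative_diff_chain_within)
    show "(?l has_vector_derivative v) (at 0)"
      by (auto intro!: derivative_eq_intros simp: has_vector_derivative_def)
    show "(F \<circ> chart_inv c has_derivative F') (at (?l 0) within ?l ` UNIV)"
      by (rule has_derivative_at_withinI) (use F' in \<open>simp add: comp_def\<close>)
  qed
  then have "((F \<circ> chart_inv c) \<circ> ?l has_real_derivative F' v) (at 0)"
    by (simp add: has_real_derivative_iff_has_vector_derivative)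
  then have "((\<lambda>h. (F (chart_inv c (?l h)) - F q) / h) \<longlongrightarrow> F' v) (at 0)"
    using c by (simp add: DERIV_def comp_def chart_inv_left)
  moreover have "F' v < - \<kappa> / C" using \<kappa>(2) \<open>C > 0\<close> by (simp add: field_simps)
  ultimately have "\<forall>\<^sub>F h in at 0. (F (chart_inv c (?l h)) - F q) / h < - \<kappa> / C"
    by (rule order_tendstoD(2))
  then obtain \<delta>\<^sub>1 where \<delta>\<^sub>1: "\<delta>\<^sub>1 > 0"
    "\<And>h. h \<noteq> 0 \<Longrightarrow> \<bar>h\<bar> < \<delta>\<^sub>1 \<Longrightarrow> (F (chart_inv c (?l h)) - F q) / h < - \<kappa> / C"
    by (auto simp: eventually_at dist_real_def)
  have oT: "open (?l -` ?Y)" by (intro open_vimage chart_open(2)[OF c(1)] continuous_intros)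
  have "continuous_on (?l -` ?Y) (\<lambda>h. sqrt (g c (chart_inv c (?l h)) v v))"
    by (intro continuous_on_real_sqrt continuous_on_compose2[OF metric_coefficient_cont[OF c(1)]]
          continuous_on_compose2[OF chart_inv_cont[OF c(1)]] continuous_intros)
       (use chart_inv_in[OF c(1)] in auto)
  moreover have "0 \<in> ?l -` ?Y" using c by simp
  ultimately have "open (?l -` ?Y \<inter> (\<lambda>h. sqrt (g c (chart_inv c (?l h)) v v)) -` {..<\<kappa>})"
    "0 \<in> ?l -` ?Y \<inter> (\<lambda>h. sqrt (g c (chart_inv c (?l h)) v v)) -` {..<\<kappa>}"
    using \<kappa>(1) c oT by (auto intro!: continuous_open_preimage simp: chart_inv_left)
  then obtain \<delta>\<^sub>2 where \<delta>\<^sub>2: "\<delta>\<^sub>2 > 0"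
    "ball 0 \<delta>\<^sub>2 \<subseteq> ?l -` ?Y \<inter> (\<lambda>h. sqrt (g c (chart_inv c (?l h)) v v)) -` {..<\<kappa>}"
    by (meson open_contains_ball)
  define \<tau> where "\<tau> = min \<delta>\<^sub>1 \<delta>\<^sub>2 / 2"
  have \<tau>: "\<tau> > 0" "\<tau> < \<delta>\<^sub>1" "\<tau> < \<delta>\<^sub>2" using \<delta>\<^sub>1(1) \<delta>\<^sub>2(1) by (auto simp: \<tau>_def)
  let ?p = "chart_inv c (?l \<tau>)"
  have near: "?l (u * \<tau>) \<in> ?Y \<and> sqrt (g c (chart_inv c (?l (u * \<tau>))) v v) < \<kappa>" if "u \<in> {0..1}" for u
  proof -
    have "u * \<tau> \<le> 1 * \<tau>" using that \<tau> by (intro mult_right_mono) auto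
    then have "u * \<tau> < \<delta>\<^sub>2" using \<tau>(3) by linarith
    moreover have "0 \<le> u * \<tau>" using that \<tau> by simp
    ultimately have "u * \<tau> \<in> ball 0 \<delta>\<^sub>2" by (simp add: dist_real_def)
    then show ?thesis using \<delta>\<^sub>2(2) by auto
  qed
  have "riemannian_dist A g (chart_inv c (snd c q)) (chart_inv c (snd c q + \<tau> *\<^sub>R v)) \<le> ennreal (\<tau> * \<kappa>)"
  proof (rule dist_straight_line[OF c(1)])
    fix u :: real assume u: "u \<in> {0..1}"
    show Y: "snd c q + u *\<^sub>R \<tau> *\<^sub>R v \<in> ?Y" using near[OF u] by simp
    show "sqrt (g c (chart_inv c (snd c q + u *\<^sub>R \<tau> *\<^sub>R v)) (\<tau> *\<^sub>R v) (\<tau> *\<^sub>R v)) \<le> \<tau> * \<kappa>"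
      using near[OF u] \<tau>(1) metric_scale[OF c(1) chart_inv_in[OF c(1) Y]]
      by (simp add: real_sqrt_mult mult_left_mono)
  qed
  moreover have drop: "\<tau> * \<kappa> < C * (F q - F ?p)"
    using \<delta>\<^sub>1(2)[of \<tau>] \<tau> \<open>C > 0\<close> by (simp add: field_simps)
  ultimately have "riemannian_dist A g q ?p \<le> ennreal (C * (F q - F ?p))"
    using c by (simp add: chart_inv_left) (meson ennreal_leI less_imp_le order_trans)
  moreover have "F ?p < F q"
  proof -
    have "0 < C * (F q - F ?p)" using drop \<open>\<kappa> > 0\<close> \<tau> mult_pos_pos[of \<tau> \<kappa>] by linarith
    then show ?thesis using \<open>C > 0\<close> by (simp add: zero_less_mult_iff)
  qed
  ultimately show ?thesis by blast
qed

text \<open>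
  At the point given by the variational principle the gradient of \<open>F\<close> has norm at most \<open>1 / C\<close>, since a
  steeper direction would lead, by \<open>descent_step\<close>, to a lower reachable point.  The gradient bound is
  stated for directional derivatives, and only where \<open>F\<close> is differentiable.
\<close>

theorem almost_critical_point:
  fixes F :: "'m \<Rightarrow> real"
  assumes complete: "riemannian_complete A g" and F: "continuous_on UNIV F" "\<And>q. 0 \<le> F q" and "C > 0"
  obtains q where "F q \<le> F q\<^sub>0"
    "\<And>c F' v. c \<in> A \<Longrightarrow> q \<in> fst c \<Longrightarrow> (F \<circ> chart_inv c has_derivative F') (at (snd c q)) \<Longrightarrow>
        - C * F' v \<le> sqrt (g c q v v)"
proof -
  have "\<exists>q. F q \<le> F q\<^sub>0 \<and> (\<forall>p. riemannian_dist A g q p \<le> ennreal (C * (F q - F p)) \<longrightarrow> F q \<le> F p)"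
  proof (rule caristi_minimum)
    fix X and q assume X: "\<forall>\<epsilon>>0. \<exists>k0::nat. \<forall>k\<ge>k0. riemannian_dist A g (X k) q < ennreal \<epsilon>"
    show "(\<lambda>k. F (X k)) \<longlonglongrightarrow> F q"
    proof (rule topological_tendstoI)
      fix V assume "open V" "F q \<in> V"
      then have "open (F -` V)" "q \<in> F -` V" using F(1) by (auto intro: open_vimage)
      then obtain \<epsilon> :: real where "\<epsilon> > 0" "\<And>p. riemannian_dist A g p q < ennreal \<epsilon> \<Longrightarrow> p \<in> F -` V"
        by (rule riemannian_dist_topology) blast
      then show "\<forall>\<^sub>F k in sequentially. F (X k) \<in> V"
        using X unfolding eventually_sequentially by (metis vimageE)
    qed
  next
    show "\<exists>q. \<forall>\<epsilon>>0. \<exists>k0. \<forall>k\<ge>k0. riemannian_dist A g (X k) q < ennreal \<epsilon>"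
      if "\<forall>\<epsilon>>0. \<exists>k0. \<forall>k\<ge>k0. \<forall>l\<ge>k0. riemannian_dist A g (X k) (X l) < ennreal \<epsilon>" for X :: "nat \<Rightarrow> 'm"
      using complete that unfolding riemannian_complete_def by blast
  qed (fact riemannian_dist_self riemannian_dist_sym riemannian_dist_triangle F(2)
      less_imp_le[OF \<open>C > 0\<close>])+
  then obtain q where q: "F q \<le> F q\<^sub>0"
    "\<And>p. riemannian_dist A g q p \<le> ennreal (C * (F q - F p)) \<Longrightarrow> F q \<le> F p" by blast
  show thesis
  proof (rule that[OF q(1)])
    fix c F' v
    assume "c \<in> A" "q \<in> fst c" "(F \<circ> chart_inv c has_derivative F') (at (snd c q))"
    from descent_step[OF this \<open>C > 0\<close>, of v] q(2)
    show "- C * F' v \<le> sqrt (g c q v v)" by (meson leD not_le)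
  qed
qed

end

section \<open>Hypersurfaces of a warped product\<close>

text \<open>
  By dimension: an injective linear map into a kernel of codimension 1 fills the kernel.  Adding the
  transversal direction \<open>n\<close> turns \<open>L\<close> into an injective, hence bijective, endomorphism.
\<close>

lemma hyperplane_is_range:
  fixes L :: "'a::euclidean_space \<Rightarrow> real \<times> 'a" and \<phi> :: "real \<times> 'a \<Rightarrow> real"
  assumes L: "linear L" "inj L" and \<phi>: "linear \<phi>" "\<And>v. \<phi> (L v) = 0" "\<phi> n \<noteq> 0" and W: "\<phi> W = 0"
  obtains v where "L v = W"
proof -
  define T where "T z = L (snd z) + fst z *\<^sub>R n" for z :: "real \<times> 'a"
  have lin: "linear T"
    unfolding T_def[abs_def]
    by (intro linear_compose_add linear_compose[OF linear_snd L(1), unfolded comp_def]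
        linearI) (auto simp: algebra_simps)
  have \<phi>T: "\<phi> (T z) = fst z * \<phi> n" for z
    by (simp add: T_def linear_add[OF \<phi>(1)] linear_scale[OF \<phi>(1)] \<phi>(2))
  have "inj T"
  proof (rule linear_injective_0[OF lin, THEN iffD2], intro allI impI)
    fix z assume z: "T z = 0"
    then have "fst z = 0" using \<phi>T[of z] \<phi>(3) linear_0[OF \<phi>(1)] by simp
    moreover have "L (snd z) = 0" using z \<open>fst z = 0\<close> by (simp add: T_def)
    ultimately show "z = 0"
      using linear_injective_0[OF L(1)] L(2) by (simp add: prod_eq_iff)
  qed
  then obtain z where z: "T z = W" using linear_injective_imp_surjective[OF lin] by (metis surjD)
  have "fst z = 0" using \<phi>T[of z] z W \<phi>(3) by simp
  then show thesis using that[of "snd z"] z by (simp add: T_def)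
qed

locale warped_hypersurface =
  M: riemannian_manifold A\<^sub>M g\<^sub>M + S: riemannian_manifold A\<^sub>\<Sigma> g\<^sub>\<Sigma>
  for A\<^sub>M :: "('m::t2_space, 'e::euclidean_space) chart set" and g\<^sub>M :: "('m, 'e) metric_field"
    and A\<^sub>\<Sigma> :: "('s::t2_space, 'e) chart set" and g\<^sub>\<Sigma> :: "('s, 'e) metric_field" +
  fixes I :: "real set" and f :: "real \<Rightarrow> real" and x :: "'s \<Rightarrow> real \<times> 'm"
    and N :: "(real \<times> 'm, real \<times> 'e) chart \<Rightarrow> 's \<Rightarrow> real \<times> 'e"
  assumes f_pos: "\<And>t. t \<in> I \<Longrightarrow> f t > 0"
    and immersion: "isometric_immersion A\<^sub>\<Sigma> g\<^sub>\<Sigma> (warped_atlas I A\<^sub>M) (warped_metric f g\<^sub>M) x"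
    and normal: "unit_normal_field A\<^sub>\<Sigma> (warped_atlas I A\<^sub>M) (warped_metric f g\<^sub>M) x N"
begin

text \<open>
  In a product chart only the chart \<open>d\<close> of the fibre matters.  Below, \<open>dx c d s\<close> and \<open>\<nu> d s\<close> are pairs of
  a component along \<open>\<partial>\<^sub>t\<close> and a component tangent to the fibre.
\<close>

definition dx where "dx c d s = differential x c (product_chart I d) s"

definition \<nu> where "\<nu> d s = N (product_chart I d) s"

lemma height_in_I: "fst (x s) \<in> I"
  using immersion
  by (auto simp: isometric_immersion_def smooth_map_def warped_atlas_def product_chart_def image_subset_iff
      dest!: spec[of _ s])

lemma x_cont: "continuous_on UNIV x"
  using immersion by (auto simp: isometric_immersion_def smooth_map_def)

lemma x_preimage: "x -` fst (product_chart I d) = (\<lambda>s. snd (x s)) -` fst d"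
  using height_in_I by (auto simp: product_chart_def mem_Times_iff)

lemma open_preimage: "d \<in> A\<^sub>M \<Longrightarrow> open ((\<lambda>s. snd (x s)) -` fst d)"
  by (intro open_vimage M.chart_open(1) continuous_on_snd x_cont)

lemma warped_metric_product:
  "warped_metric f g\<^sub>M (product_chart I d) (x s) V W
     = fst V * fst W + (f (fst (x s)))\<^sup>2 * g\<^sub>M d (snd (x s)) (snd V) (snd W)"
proof -
  have "I \<noteq> {}" using height_in_I by blast
  then show ?thesis by (simp add: warped_metric_def fibre_chart_product_chart)
qed

lemma dx_has_derivative:
  assumes c: "c \<in> A\<^sub>\<Sigma>" "s \<in> fst c" and d: "d \<in> A\<^sub>M" "snd (x s) \<in> fst d"
  shows "((\<lambda>z. (fst (x (chart_inv c z)), snd d (snd (x (chart_inv c z))))) has_derivative dx c d s)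
           (at (snd c s))"
proof -
  let ?D = "product_chart I d"
  let ?S = "snd c ` (fst c \<inter> x -` fst ?D)" and ?\<xi> = "snd ?D \<circ> x \<circ> chart_inv c"
  have "smooth_map A\<^sub>\<Sigma> (warped_atlas I A\<^sub>M) x" using immersion by (simp add: isometric_immersion_def)
  then have "smooth_on ?S ?\<xi>" using c d by (auto simp: smooth_map_def warped_atlas_def)
  then have "Ck_on (Suc 0) ?S ?\<xi>" by (simp only: smooth_on_def)
  then have diff: "?\<xi> differentiable_on ?S" by simp
  have oS: "open ?S" unfolding x_preimage by (rule S.chart_image_open[OF c(1) open_preimage[OF d(1)]])
  have mem: "snd c s \<in> ?S" using c d by (auto simp: x_preimage)
  have "?\<xi> differentiable at (snd c s)"
    using bspec[OF diff[unfolded differentiable_on_def] mem] unfolding at_within_open[OF mem oS] .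
  then have "(?\<xi> has_derivative dx c d s) (at (snd c s))"
    by (simp add: dx_def differential_def frechet_derivative_works)
  moreover have "?\<xi> = (\<lambda>z. (fst (x (chart_inv c z)), snd d (snd (x (chart_inv c z)))))"
    by (auto simp: fun_eq_iff product_chart_def split_beta)
  ultimately show ?thesis by simp
qed

lemma height_has_derivative:
  assumes "c \<in> A\<^sub>\<Sigma>" "s \<in> fst c" "d \<in> A\<^sub>M" "snd (x s) \<in> fst d"
  shows "((\<lambda>z. fst (x (chart_inv c z))) has_derivative (\<lambda>v. fst (dx c d s v))) (at (snd c s))"
  using has_derivative_fst[OF dx_has_derivative[OF assms]] by simp

lemma fibre_has_derivative:
  assumes "c \<in> A\<^sub>\<Sigma>" "s \<in> fst c" "d \<in> A\<^sub>M" "snd (x s) \<in> fst d"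
  shows "((\<lambda>z. snd d (snd (x (chart_inv c z)))) has_derivative (\<lambda>v. snd (dx c d s v))) (at (snd c s))"
  using has_derivative_snd[OF dx_has_derivative[OF assms]] by simp

lemma induced_metric:
  assumes "c \<in> A\<^sub>\<Sigma>" "s \<in> fst c" "d \<in> A\<^sub>M" "snd (x s) \<in> fst d"
  shows "g\<^sub>\<Sigma> c s v v = (fst (dx c d s v))\<^sup>2
           + (f (fst (x s)))\<^sup>2 * g\<^sub>M d (snd (x s)) (snd (dx c d s v)) (snd (dx c d s v))"
    and inj_dx: "inj (dx c d s)"
proof -
  have D: "product_chart I d \<in> warped_atlas I A\<^sub>M" "s \<in> fst c \<inter> x -` fst (product_chart I d)"
    using assms by (auto simp: warped_atlas_def x_preimage)
  have *: "inj (differential x c (product_chart I d) s) \<and>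
      (\<forall>v w. g\<^sub>\<Sigma> c s v w = warped_metric f g\<^sub>M (product_chart I d) (x s)
        (differential x c (product_chart I d) s v) (differential x c (product_chart I d) s w))"
    using immersion[unfolded isometric_immersion_def, THEN conjunct2] D assms(1) by blast
  show "inj (dx c d s)" unfolding dx_def[abs_def] using * by blast
  have "g\<^sub>\<Sigma> c s v v = warped_metric f g\<^sub>M (product_chart I d) (x s) (dx c d s v) (dx c d s v)"
    unfolding dx_def using * by blast
  then show "g\<^sub>\<Sigma> c s v v = (fst (dx c d s v))\<^sup>2
           + (f (fst (x s)))\<^sup>2 * g\<^sub>M d (snd (x s)) (snd (dx c d s v)) (snd (dx c d s v))"
    by (simp add: warped_metric_product power2_eq_square)
qed

lemma normal_unit:
  assumes "d \<in> A\<^sub>M" "snd (x s) \<in> fst d"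
  shows "(fst (\<nu> d s))\<^sup>2 + (f (fst (x s)))\<^sup>2 * g\<^sub>M d (snd (x s)) (snd (\<nu> d s)) (snd (\<nu> d s)) = 1"
proof -
  have D: "product_chart I d \<in> warped_atlas I A\<^sub>M" "s \<in> x -` fst (product_chart I d)"
    using assms by (auto simp: warped_atlas_def x_preimage)
  have "warped_metric f g\<^sub>M (product_chart I d) (x s) (\<nu> d s) (\<nu> d s) = 1"
    unfolding \<nu>_def
    using normal[unfolded unit_normal_field_def, THEN conjunct2, THEN conjunct2, THEN conjunct1] D by blast
  then show ?thesis by (simp add: warped_metric_product power2_eq_square)
qed

lemma normal_orthogonal:
  assumes "c \<in> A\<^sub>\<Sigma>" "s \<in> fst c" "d \<in> A\<^sub>M" "snd (x s) \<in> fst d"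
  shows "fst (\<nu> d s) * fst (dx c d s v)
      + (f (fst (x s)))\<^sup>2 * g\<^sub>M d (snd (x s)) (snd (\<nu> d s)) (snd (dx c d s v)) = 0"
proof -
  have D: "product_chart I d \<in> warped_atlas I A\<^sub>M" "s \<in> fst c \<inter> x -` fst (product_chart I d)"
    using assms by (auto simp: warped_atlas_def x_preimage)
  have "warped_metric f g\<^sub>M (product_chart I d) (x s) (\<nu> d s) (dx c d s v) = 0"
    unfolding \<nu>_def dx_def
    using normal[unfolded unit_normal_field_def, THEN conjunct2, THEN conjunct2, THEN conjunct2] D assms(1)
    by blast
  then show ?thesis by (simp add: warped_metric_product)
qed

text \<open>
  The tangent space of the hypersurface has codimension 1, so it is the whole orthogonal complement of
  the normal.  This is the source of tangent vectors with prescribed components.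
\<close>

lemma tangent_vector_exists:
  assumes cd: "c \<in> A\<^sub>\<Sigma>" "s \<in> fst c" "d \<in> A\<^sub>M" "snd (x s) \<in> fst d"
    and W: "fst (\<nu> d s) * fst W + (f (fst (x s)))\<^sup>2 * g\<^sub>M d (snd (x s)) (snd (\<nu> d s)) (snd W) = 0"
  obtains v where "dx c d s v = W"
proof (rule hyperplane_is_range)
  show "linear (dx c d s)" using dx_has_derivative[OF cd] by (rule has_derivative_linear)
  show "inj (dx c d s)" by (rule inj_dx[OF cd])
  let ?\<phi> = "\<lambda>W. fst (\<nu> d s) * fst W + (f (fst (x s)))\<^sup>2 * g\<^sub>M d (snd (x s)) (snd (\<nu> d s)) (snd W)"
  note b = M.metric_bilinear[OF cd(3,4)]
  show "linear ?\<phi>"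
    by (rule linearI) (auto simp: bilinear_radd[OF b] bilinear_rmul[OF b] algebra_simps)
  show "?\<phi> (dx c d s v) = 0" for v by (rule normal_orthogonal[OF cd])
  show "?\<phi> (\<nu> d s) \<noteq> 0" using normal_unit[OF cd(3,4)] by (simp add: power2_eq_square)
  show "?\<phi> W = 0" by (rule W)
qed

lemma angle_eq_fst:
  assumes "d \<in> A\<^sub>M" "snd (x s) \<in> fst d"
  shows "warped_metric f g\<^sub>M (product_chart I d) (x s) (N (product_chart I d) s) (1, 0) = fst (\<nu> d s)"
  using bilinear_rzero[OF M.metric_bilinear[OF assms]] by (simp add: warped_metric_product \<nu>_def)

section \<open>The height function of a helix type hypersurface\<close>

text \<open>
  The gradient of the height function is the tangential part \<open>\<partial>\<^sub>t - \<theta> N\<close> of \<open>\<partial>\<^sub>t\<close>, of constant length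
  \<open>sqrt (1 - \<theta>\<^sup>2)\<close>.  On a complete manifold a function bounded above has points with arbitrarily small
  gradient, so this length cannot be positive.
\<close>

lemma steep_height_unbounded:
  assumes complete: "riemannian_complete A\<^sub>\<Sigma> g\<^sub>\<Sigma>"
    and angle: "\<And>d s. d \<in> A\<^sub>M \<Longrightarrow> snd (x s) \<in> fst d \<Longrightarrow> fst (\<nu> d s) = \<theta>"
    and "\<theta>\<^sup>2 < 1" and bound: "\<And>s. fst (x s) \<le> t\<^sub>2"
  shows False
proof -
  let ?F = "\<lambda>s. t\<^sub>2 - fst (x s)"
  define m where "m = sqrt (1 - \<theta>\<^sup>2)"
  have m: "m > 0" "m * m = 1 - \<theta>\<^sup>2" using \<open>\<theta>\<^sup>2 < 1\<close> by (auto simp: m_def)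
  \<comment> \<open>With \<open>C = 2 / m\<close> the gradient at \<open>s\<close> has norm at most \<open>m / 2\<close>, half of its actual length.\<close>
  obtain s where s: "\<And>c F' v. c \<in> A\<^sub>\<Sigma> \<Longrightarrow> s \<in> fst c \<Longrightarrow>
      (?F \<circ> chart_inv c has_derivative F') (at (snd c s)) \<Longrightarrow> - (2 / m) * F' v \<le> sqrt (g\<^sub>\<Sigma> c s v v)"
  proof (rule S.almost_critical_point[OF complete, of ?F "2 / m"])
    show "continuous_on UNIV ?F" by (intro continuous_intros x_cont)
  qed (use bound m in auto)
  obtain c where c: "c \<in> A\<^sub>\<Sigma>" "s \<in> fst c" using S.chart_exists .
  obtain d where d: "d \<in> A\<^sub>M" "snd (x s) \<in> fst d" using M.chart_exists .
  note b = M.metric_bilinear[OF d]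
  let ?n = "\<nu> d s" and ?G = "\<lambda>v w. (f (fst (x s)))\<^sup>2 * g\<^sub>M d (snd (x s)) v w"
  have n1: "fst ?n = \<theta>" by (rule angle[OF d])
  have nn: "?G (snd ?n) (snd ?n) = 1 - \<theta>\<^sup>2" using normal_unit[OF d] n1 by simp
  define W where "W = (1, 0) - \<theta> *\<^sub>R ?n"
  have W: "fst W = 1 - \<theta>\<^sup>2" "snd W = (- \<theta>) *\<^sub>R snd ?n"
    using n1 by (simp_all add: W_def power2_eq_square)
  have "fst ?n * fst W + ?G (snd ?n) (snd W) = \<theta> * (1 - \<theta>\<^sup>2) - \<theta> * ?G (snd ?n) (snd ?n)"
    unfolding W n1 bilinear_rmul[OF b] by simp
  then have "fst ?n * fst W + ?G (snd ?n) (snd W) = 0" unfolding nn by simp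
  then obtain v where v: "dx c d s v = W" using tangent_vector_exists[OF c d] by blast
  have "g\<^sub>\<Sigma> c s v v = (1 - \<theta>\<^sup>2)\<^sup>2 + \<theta>\<^sup>2 * ?G (snd ?n) (snd ?n)"
    unfolding induced_metric[OF c d] v W bilinear_rmul[OF b] bilinear_lmul[OF b]
    by (simp add: power2_eq_square)
  also have "\<dots> = 1 - \<theta>\<^sup>2" unfolding nn by (simp add: power2_eq_square algebra_simps)
  finally have gv: "g\<^sub>\<Sigma> c s v v = 1 - \<theta>\<^sup>2" .
  have "(?F \<circ> chart_inv c has_derivative (\<lambda>v. - fst (dx c d s v))) (at (snd c s))"
    using has_derivative_diff[OF has_derivative_const[of t\<^sub>2] height_has_derivative[OF c d]]
    by (simp add: comp_def)
  from s[OF c this, of v] have "- (2 / m) * - (1 - \<theta>\<^sup>2) \<le> m"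
    unfolding v W(1) gv m_def .
  then have "- (2 / m) * - (m * m) \<le> m" unfolding m(2) .
  then show False using m(1) by simp
qed

lemma horizontal_tangent_planes:
  assumes angle: "\<And>d s. d \<in> A\<^sub>M \<Longrightarrow> snd (x s) \<in> fst d \<Longrightarrow> fst (\<nu> d s) = \<theta>" and "\<theta>\<^sup>2 = 1"
    and cd: "c \<in> A\<^sub>\<Sigma>" "s \<in> fst c" "d \<in> A\<^sub>M" "snd (x s) \<in> fst d"
  shows "snd (\<nu> d s) = 0" "fst (dx c d s v) = 0"
proof -
  have "(f (fst (x s)))\<^sup>2 * g\<^sub>M d (snd (x s)) (snd (\<nu> d s)) (snd (\<nu> d s)) = 0"
    using normal_unit[OF cd(3,4)] angle[OF cd(3,4)] \<open>\<theta>\<^sup>2 = 1\<close> by simp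
  then have "g\<^sub>M d (snd (x s)) (snd (\<nu> d s)) (snd (\<nu> d s)) = 0"
    using f_pos[OF height_in_I[of s]] by simp
  then show n: "snd (\<nu> d s) = 0" using M.metric_pos[OF cd(3,4), of "snd (\<nu> d s)"] by auto
  show "fst (dx c d s v) = 0"
    using normal_orthogonal[OF cd, of v] angle[OF cd(3,4)] \<open>\<theta>\<^sup>2 = 1\<close> bilinear_lzero[OF M.metric_bilinear[OF cd(3,4)]]
    by (auto simp: n)
qed

lemma height_constant:
  assumes conn: "connected (UNIV :: 's set)"
    and flat: "\<And>c d s v. c \<in> A\<^sub>\<Sigma> \<Longrightarrow> s \<in> fst c \<Longrightarrow> d \<in> A\<^sub>M \<Longrightarrow> snd (x s) \<in> fst d \<Longrightarrow> fst (dx c d s v) = 0"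
  obtains t where "\<And>s. fst (x s) = t"
proof -
  have "(\<lambda>s. fst (x s)) constant_on UNIV"
  proof (rule locally_constant_imp_constant[OF conn])
    fix s :: 's
    obtain c where c: "c \<in> A\<^sub>\<Sigma>" "s \<in> fst c" using S.chart_exists .
    obtain r where r: "r > 0" "ball (snd c s) r \<subseteq> snd c ` fst c"
      using S.chart_open(2)[OF c(1)] c(2) by (meson imageI open_contains_ball)
    have zero: "((\<lambda>z. fst (x (chart_inv c z))) has_derivative (\<lambda>v. 0)) (at z within ball (snd c s) r)"
      if z: "z \<in> ball (snd c s) r" for z
    proof -
      have in_c: "chart_inv c z \<in> fst c" "snd c (chart_inv c z) = z"
        using r(2) z S.chart_inv_in[OF c(1)] S.chart_inv_right[OF c(1)] by auto
      obtain d where d: "d \<in> A\<^sub>M" "snd (x (chart_inv c z)) \<in> fst d" using M.chart_exists .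
      show ?thesis
        using height_has_derivative[OF c(1) in_c(1) d] flat[OF c(1) in_c(1) d] in_c(2)
        by (simp add: has_derivative_at_withinI)
    qed
    then obtain k where k: "\<And>z. z \<in> ball (snd c s) r \<Longrightarrow> fst (x (chart_inv c z)) = k"
      using has_derivative_zero_constant[OF convex_ball] by blast
    let ?T = "fst c \<inter> snd c -` ball (snd c s) r"
    have "open ?T" by (intro continuous_open_preimage S.chart_cont S.chart_open c open_ball)
    moreover have "fst (x p) = k" if "p \<in> ?T" for p
      using k[of "snd c p"] that S.chart_inv_left[OF c(1)] by simp
    ultimately show "\<exists>T. openin (top_of_set UNIV) T \<and> s \<in> T \<and> (\<forall>p\<in>T. fst (x p) = fst (x s))"
      using c r by (intro exI[of _ ?T]) auto
  qed
  then show thesis using that by (auto simp: constant_on_def)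
qed

section \<open>A complete horizontal hypersurface covers the fibre\<close>

text \<open>
  Coverage of the fibre spreads over coordinate balls.  On a horizontal hypersurface at height \<open>t\<close> the
  projection to the fibre has bijective differential and multiplies lengths by \<open>1 / f t\<close>.  Hence the
  coordinate distance from the projection to \<open>q\<close>, pulled back to the hypersurface and cut off outside
  the ball, has gradient at least \<open>1 / (f t * b)\<close> wherever it is positive and below the cut-off, \<open>b\<close> being
  the comparison constant of the metric with the Euclidean one.  An almost critical point below the
  starting value \<open>\<Phi> (snd (x s\<^sub>0)) < 2 * r\<close>, for the rate \<open>f t * b + 1\<close>, must therefore be a zero, that
  is, a preimage of \<open>q\<close>.
\<close>

lemma fibre_ball_covered:
  assumes complete: "riemannian_complete A\<^sub>\<Sigma> g\<^sub>\<Sigma>"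
    and horizontal: "\<And>d s. d \<in> A\<^sub>M \<Longrightarrow> snd (x s) \<in> fst d \<Longrightarrow> snd (\<nu> d s) = 0"
    and height: "\<And>s. fst (x s) = t"
    and d: "d \<in> A\<^sub>M" and ball: "cball y\<^sub>0 (3 * r) \<subseteq> snd d ` fst d"
    and s\<^sub>0: "snd (x s\<^sub>0) \<in> fst d" "snd d (snd (x s\<^sub>0)) \<in> ball y\<^sub>0 r"
    and q: "q \<in> fst d" "snd d q \<in> ball y\<^sub>0 r"
  shows "q \<in> range (\<lambda>s. snd (x s))"
proof -
  let ?y = "snd d q"
  \<comment> \<open>In coordinates \<open>q\<close> and the projection of \<open>s\<^sub>0\<close> both lie within \<open>r\<close> of \<open>y\<^sub>0\<close>, hence within
      \<open>2 * r\<close> of each other, and a ball of radius \<open>2 * r\<close> around \<open>snd d q\<close> stays inside the given one.\<close>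
  have sub: "cball ?y (2 * r) \<subseteq> cball y\<^sub>0 (3 * r)"
    using q(2) by (intro subsetI) (smt (verit) dist_triangle mem_ball mem_cball)
  then have sub': "cball ?y (2 * r) \<subseteq> snd d ` fst d" using ball by blast
  obtain b where b: "b > 0"
    "\<And>y v. y \<in> cball ?y (2 * r) \<Longrightarrow> sqrt (g\<^sub>M d (chart_inv d y) v v) \<le> b * norm v"
    using M.metric_comparable_on_compact[OF d compact_cball sub'] by metis
  define \<rho> where "\<rho> y = min (norm (y - ?y)) (2 * r)" for y
  have \<rho>_cont: "continuous_on UNIV \<rho>" unfolding \<rho>_def[abs_def] by (intro continuous_intros)
  have \<rho>_out: "\<rho> y = 2 * r" if "y \<notin> cball ?y (2 * r)" for y
    using that by (simp add: \<rho>_def dist_norm norm_minus_commute)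
  define \<Phi> where "\<Phi> p = (if p \<in> fst d then \<rho> (snd d p) else 2 * r)" for p
  have \<Phi>_cont: "continuous_on UNIV \<Phi>"
    using M.extend_by_constant(1)[OF d sub' \<rho>_cont \<rho>_out] unfolding \<Phi>_def[abs_def] .
  let ?F = "\<lambda>s. \<Phi> (snd (x s))"
  have F_cont: "continuous_on UNIV ?F"
    by (rule continuous_on_compose2[OF \<Phi>_cont continuous_on_snd[OF x_cont]]) simp
  have "r > 0" using q(2) by (metis ball_eq_empty empty_iff not_le)
  have F_nonneg: "0 \<le> ?F s" for s using \<open>r > 0\<close> by (simp add: \<Phi>_def \<rho>_def)
  have ft: "f t > 0" using f_pos[OF height_in_I] height by simp
  have C: "f t * b + 1 > 0" using ft b(1) by (simp add: add_pos_pos)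
  obtain s where s: "?F s \<le> ?F s\<^sub>0" "\<And>c F' v. c \<in> A\<^sub>\<Sigma> \<Longrightarrow> s \<in> fst c \<Longrightarrow>
      (?F \<circ> chart_inv c has_derivative F') (at (snd c s)) \<Longrightarrow>
      - (f t * b + 1) * F' v \<le> sqrt (g\<^sub>\<Sigma> c s v v)"
    using S.almost_critical_point[OF complete F_cont F_nonneg C, of s\<^sub>0] by metis
  have "dist ?y (snd d (snd (x s\<^sub>0))) < 2 * r"
    using s\<^sub>0(2) q(2) dist_triangle2[of ?y "snd d (snd (x s\<^sub>0))" y\<^sub>0] by (simp add: dist_commute)
  then have "?F s < 2 * r" using s(1) s\<^sub>0(1) by (simp add: \<Phi>_def \<rho>_def dist_norm norm_minus_commute)
  have near: "snd (x p) \<in> fst d \<and> ?F p = norm (snd d (snd (x p)) - ?y) \<and> norm (snd d (snd (x p)) - ?y) < 2 * r"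
    if "?F p < 2 * r" for p
    using that by (auto simp: \<Phi>_def \<rho>_def min_def split: if_splits)
  note xs = near[OF \<open>?F s < 2 * r\<close>]
  define w where "w = ?y - snd d (snd (x s))"
  have "w = 0"
  proof (rule ccontr)
    assume w: "w \<noteq> 0"
    obtain c where c: "c \<in> A\<^sub>\<Sigma>" "s \<in> fst c" using S.chart_exists .
    have sd: "snd (x s) \<in> fst d" using xs by simp
    note bil = M.metric_bilinear[OF d sd]
    \<comment> \<open>The tangent vector pointing straight at \<open>q\<close> in coordinates.\<close>
    obtain v where v: "dx c d s v = (0, w)"
      using tangent_vector_exists[OF c d sd, of "(0, w)"] horizontal[OF d sd] bilinear_lzero[OF bil] by auto
    have "((\<lambda>z. snd d (snd (x (chart_inv c z))) - ?y) has_derivative (\<lambda>v. snd (dx c d s v))) (at (snd c s))"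
      using has_derivative_diff[OF fibre_has_derivative[OF c d sd] has_derivative_const[of ?y]] by simp
    from diff_chain_at[OF this, of norm "\<lambda>h. h \<bullet> sgn (- w)"] has_derivative_norm[of "- w"] w
    have "((\<lambda>z. norm (snd d (snd (x (chart_inv c z))) - ?y)) has_derivative
        (\<lambda>v. snd (dx c d s v) \<bullet> sgn (- w))) (at (snd c s))"
      by (simp add: comp_def w_def S.chart_inv_left[OF c])
    then have "(?F \<circ> chart_inv c has_derivative (\<lambda>v. snd (dx c d s v) \<bullet> sgn (- w))) (at (snd c s))"
    proof (rule has_derivative_transform_within_open[where s = "snd c ` (fst c \<inter> ?F -` {..<2 * r})"])
      show "open (snd c ` (fst c \<inter> ?F -` {..<2 * r}))"
        by (intro S.chart_image_open c open_vimage F_cont open_lessThan)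
      show "snd c s \<in> snd c ` (fst c \<inter> ?F -` {..<2 * r})" using c \<open>?F s < 2 * r\<close> by auto
      fix z assume "z \<in> snd c ` (fst c \<inter> ?F -` {..<2 * r})"
      then have "?F (chart_inv c z) < 2 * r" using S.chart_inv_left[OF c(1)] by auto
      from near[OF this] show "norm (snd d (snd (x (chart_inv c z))) - ?y) = (?F \<circ> chart_inv c) z" by simp
    qed
    from s(2)[OF c this, of v]
    have "- (f t * b + 1) * (w \<bullet> sgn (- w)) \<le> sqrt (g\<^sub>\<Sigma> c s v v)" unfolding v by simp
    moreover have "w \<bullet> sgn (- w) = - norm w"
      using w by (simp add: sgn_div_norm power2_norm_eq_inner[symmetric] power2_eq_square)
    ultimately have "- (f t * b + 1) * - norm w \<le> sqrt (g\<^sub>\<Sigma> c s v v)" by (simp only:)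
    then have "(f t * b + 1) * norm w \<le> sqrt (g\<^sub>\<Sigma> c s v v)" by (simp only: minus_mult_minus)
    also have "\<dots> = f t * sqrt (g\<^sub>M d (snd (x s)) w w)"
      using ft by (simp add: induced_metric[OF c d sd] v height real_sqrt_mult)
    also have "\<dots> \<le> f t * (b * norm w)"
      using b(2)[of "snd d (snd (x s))" w] xs ft M.chart_inv_left[OF d sd]
      by (intro mult_left_mono) (auto simp: w_def dist_norm norm_minus_commute)
    finally show False using w by (simp add: algebra_simps)
  qed
  then have "chart_inv d (snd d (snd (x s))) = chart_inv d ?y" by (simp add: w_def)
  moreover have "chart_inv d (snd d (snd (x s))) = snd (x s)"
    by (rule M.chart_inv_left[OF d conjunct1[OF xs]])
  moreover have "chart_inv d ?y = q" by (rule M.chart_inv_left[OF d q(1)])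
  ultimately have "snd (x s) = q" by (simp only:)
  then show ?thesis by blast
qed

text \<open>
  Membership in the image of the projection is locally constant by \<open>fibre_ball_covered\<close>, so the image is
  open and closed in the connected fibre.
\<close>

lemma fibre_covered:
  assumes complete: "riemannian_complete A\<^sub>\<Sigma> g\<^sub>\<Sigma>" and conn: "connected (UNIV :: 'm set)"
    and horizontal: "\<And>d s. d \<in> A\<^sub>M \<Longrightarrow> snd (x s) \<in> fst d \<Longrightarrow> snd (\<nu> d s) = 0"
    and height: "\<And>s. fst (x s) = t"
  shows "range (\<lambda>s. snd (x s)) = UNIV"
proof -
  let ?R = "range (\<lambda>s. snd (x s))"
  have "(\<lambda>q. q \<in> ?R) constant_on UNIV"
  proof (rule locally_constant_imp_constant[OF conn])
    fix p :: 'm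
    obtain d where d: "d \<in> A\<^sub>M" "p \<in> fst d" using M.chart_exists .
    obtain R where R: "R > 0" "cball (snd d p) R \<subseteq> snd d ` fst d"
      using M.chart_open(2)[OF d(1)] d(2) by (meson imageI open_contains_cball)
    let ?T = "fst d \<inter> snd d -` ball (snd d p) (R / 3)"
    have o: "open ?T" by (intro continuous_open_preimage M.chart_cont M.chart_open d open_ball)
    have pT: "p \<in> ?T" using d R by simp
    have "q' \<in> ?R" if q: "q \<in> ?T" "q \<in> ?R" "q' \<in> ?T" for q q'
    proof -
      obtain s\<^sub>0 where "q = snd (x s\<^sub>0)" using q(2) by blast
      then show ?thesis
        using fibre_ball_covered[OF complete horizontal height d(1), of "snd d p" "R / 3" s\<^sub>0 q'] R q by simp
    qed
    then have "\<forall>q\<in>?T. (q \<in> ?R) = (p \<in> ?R)" using pT by blast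
    moreover have "openin (top_of_set UNIV) ?T" using o by simp
    ultimately show "\<exists>T. openin (top_of_set UNIV) T \<and> p \<in> T \<and> (\<forall>q\<in>T. (q \<in> ?R) = (p \<in> ?R))"
      using pT by (intro exI[of _ ?T] conjI)
  qed
  then obtain k where k: "\<And>q. (q \<in> ?R) = k" unfolding constant_on_def by blast
  moreover have "snd (x s) \<in> ?R" for s by (rule rangeI)
  ultimately show ?thesis by (metis UNIV_eq_I)
qed

end

theorem theorem4p7:
  fixes A\<^sub>M :: "('m::{t2_space,second_countable_topology}, real^'n) chart set"
    and g\<^sub>M :: "('m, real^'n) metric_field"
    and I :: "real set" and f :: "real \<Rightarrow> real"
    and A\<^sub>\<Sigma> :: "('s::{t2_space,second_countable_topology}, real^'n) chart set"
    and g\<^sub>\<Sigma> :: "('s, real^'n) metric_field"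
    and vol\<^sub>\<Sigma> :: "'s measure"
    and x :: "'s \<Rightarrow> real \<times> 'm"
    and N :: "(real \<times> 'm, real \<times> (real^'n)) chart \<Rightarrow> 's \<Rightarrow> real \<times> (real^'n)"
    and H :: "'s \<Rightarrow> real" and p :: real
  assumes "CARD('n) \<ge> 2"
    and "connected_riemannian_manifold A\<^sub>M g\<^sub>M" and "oriented_atlas A\<^sub>M"
    and "is_interval I" and "smooth_on I f" and "\<And>t. t \<in> I \<Longrightarrow> f t > 0"
    and "\<And>t. t \<in> I \<Longrightarrow> log_deriv I f t \<ge> 1"
    and "p > 2"
    and "connected_riemannian_manifold A\<^sub>\<Sigma> g\<^sub>\<Sigma>"
    and "isometric_immersion A\<^sub>\<Sigma> g\<^sub>\<Sigma> (warped_atlas I A\<^sub>M) (warped_metric f g\<^sub>M) x"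
    and "unit_normal_field A\<^sub>\<Sigma> (warped_atlas I A\<^sub>M) (warped_metric f g\<^sub>M) x N"
    and "riemannian_complete A\<^sub>\<Sigma> g\<^sub>\<Sigma>" and "\<not> compact (UNIV :: 's set)"
    and "helix_type (warped_atlas I A\<^sub>M) (warped_metric f g\<^sub>M) x N"
    and "in_slab I x"
    and "is_riemannian_volume A\<^sub>\<Sigma> g\<^sub>\<Sigma> vol\<^sub>\<Sigma>"
    and "first_eigenvalue A\<^sub>\<Sigma> g\<^sub>\<Sigma> vol\<^sub>\<Sigma> p = 0"
    and "is_mean_curvature A\<^sub>\<Sigma> (warped_atlas I A\<^sub>M) (warped_metric f g\<^sub>M) x N H" and "\<And>s. (H s)\<^sup>2 \<le> 1"
  shows "is_slice I x"
proof -
  interpret M: riemannian_manifold A\<^sub>M g\<^sub>M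
    using assms(2) by unfold_locales (auto simp: connected_riemannian_manifold_def)
  interpret S: riemannian_manifold A\<^sub>\<Sigma> g\<^sub>\<Sigma>
    using assms(9) by unfold_locales (auto simp: connected_riemannian_manifold_def)
  interpret warped_hypersurface A\<^sub>M g\<^sub>M A\<^sub>\<Sigma> g\<^sub>\<Sigma> I f x N
    using assms(6,10,11) by unfold_locales
  have conn: "connected (UNIV :: 'm set)" "connected (UNIV :: 's set)"
    using assms(2,9) by (auto simp: connected_riemannian_manifold_def)
  obtain \<theta> where \<theta>: "\<And>D s. D \<in> warped_atlas I A\<^sub>M \<Longrightarrow> s \<in> x -` fst D \<Longrightarrow>
      warped_metric f g\<^sub>M D (x s) (N D s) (1, 0) = \<theta>"
    using assms(14) by (auto simp: helix_type_def)
  have angle: "fst (\<nu> d s) = \<theta>" if d: "d \<in> A\<^sub>M" "snd (x s) \<in> fst d" for d s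
  proof -
    have "product_chart I d \<in> warped_atlas I A\<^sub>M" "s \<in> x -` fst (product_chart I d)"
      using d by (auto simp: warped_atlas_def x_preimage)
    from \<theta>[OF this] show ?thesis by (simp add: angle_eq_fst[OF d])
  qed
  obtain t\<^sub>2 where t\<^sub>2: "\<And>s. fst (x s) \<le> t\<^sub>2"
    using assms(15) by (auto simp: in_slab_def image_subset_iff mem_Times_iff)
  have "\<theta>\<^sup>2 \<le> 1"
  proof -
    fix s :: 's
    obtain d where d: "d \<in> A\<^sub>M" "snd (x s) \<in> fst d" using M.chart_exists .
    have "0 \<le> (f (fst (x s)))\<^sup>2 * g\<^sub>M d (snd (x s)) (snd (\<nu> d s)) (snd (\<nu> d s))"
      by (intro mult_nonneg_nonneg M.metric_nonneg d) simp
    then show ?thesis using normal_unit[OF d] angle[OF d] by simp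
  qed
  moreover have "\<not> \<theta>\<^sup>2 < 1" using steep_height_unbounded[OF assms(12) angle _ t\<^sub>2] by blast
  ultimately have \<theta>1: "\<theta>\<^sup>2 = 1" by simp
  obtain t where t: "\<And>s. fst (x s) = t"
    using height_constant[OF conn(2) horizontal_tangent_planes(2)[OF angle \<theta>1]] by blast
  have horizontal: "snd (\<nu> d s) = 0" if d: "d \<in> A\<^sub>M" "snd (x s) \<in> fst d" for d s
  proof -
    obtain c where c: "c \<in> A\<^sub>\<Sigma>" "s \<in> fst c" using S.chart_exists .
    show ?thesis by (rule horizontal_tangent_planes(1)[OF _ \<theta>1 c d]) (rule angle)
  qed
  have surj: "range (\<lambda>s. snd (x s)) = UNIV" by (rule fibre_covered[OF assms(12) conn(1) horizontal t])
  have "range x = range (\<lambda>s. (t, snd (x s)))" by (rule image_cong[OF refl]) (simp add: prod_eq_iff t)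
  also have "\<dots> = Pair t ` range (\<lambda>s. snd (x s))" by (simp only: image_image)
  also have "\<dots> = {t} \<times> UNIV" unfolding surj by auto
  finally have "range x = {t} \<times> UNIV" .
  moreover have "t \<in> I" using height_in_I t by metis
  ultimately show ?thesis unfolding is_slice_def by blast
qed

end
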